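(* Let $N\ge 1$, let $m_0,\dots,m_N>0$, $I_0,\dots,I_N>0$, $a_0>0$, $c_1,\dots,c_N>0$, $a_1,\dots,a_N\in\mathbb{R}$, and put $$J=I_0+m_0a_0^2,\quad b=m_0a_0,\quad m=\sum_{i=0}^N m_i,\quad \mu_i=\frac{1}{c_i^2}\big(I_i+m_ia_i(a_i-2c_i)\big).$$ Let $k:\mathbb{R}\to\mathbb{R}$ be a smooth nonconstant periodic function of period $P>0$. For $\boldsymbol{\theta}=(\theta_1,\dots,\theta_N)$ put $$\Phi_0(\boldsymbol{\theta})=m+\sum_{i=1}^N\mu_i\sin^2\theta_i,\qquad \Phi_1(\boldsymbol{\theta})=\sum_{i=1}^N\mu_i\sin(2\theta_i)\Big[\frac{\sin\theta_i}{2c_i}+\sum_{j=1}^{i-1}\frac{\sin\theta_j}{c_j}\Big],\qquad \Phi_2(\boldsymbol{\theta})=\frac12\sum_{i=1}^N\mu_i\sin(2\theta_i).$$ Consider the non-autonomous system for $(v_1,\omega,\theta_1,\dots,\theta_N)$, where the dot denotes $d/dt$: $$\Phi_0(\boldsymbol{\theta})\dot v_1=b\omega^2+\Phi_1(\boldsymbol{\theta})v_1^2+\Phi_2(\boldsymbol{\theta})\,\omega v_1,\qquad J\dot\omega=-b\,\omega v_1-\dot k(t),$$ $$\dot\theta_i=-\frac{v_1}{c_i}\sin\theta_i-2\sum_{j=1}^{i-1}\frac{v_1}{c_j}\sin\theta_j-\omega,\qquad i=1,\dots,N.$$ Then there exist a small enough $\varepsilon>0$ and positive constants $\widetilde\omega,\widetilde\theta_1,\dots,\widetilde\theta_N$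 such that for every trajectory of this system whose initial conditions satisfy $$v_1>\frac1\varepsilon,\qquad |\omega|<\widetilde\omega\,\varepsilon^2,\qquad |\theta_i|<\widetilde\theta_i\,\varepsilon^2\quad(i=1,\dots,N),$$ one has, as $t\to+\infty$, $v_1\to+\infty$, $\omega\to0$, $\theta_i\to0$, in the form $$v_1(t)=\Delta^{1/3}t^{1/3}+o(t^{1/3}),\qquad \omega(t)=-\frac{\dot k(t)}{b\,\Delta^{1/3}}\,t^{-1/3}+o(t^{-1/3}),$$ $$\theta_i(t)=(-1)^{i+1}\frac{c_i\,\dot k(t)}{b}\,\Delta^{-2/3}t^{-2/3}+o(t^{-2/3}),\qquad i=1,\dots,N,$$ where $$\Delta=\frac{3\langle\dot k^2\rangle}{b\,m},\qquad \langle\dot k^2\rangle=\frac1P\int_0^P\dot k(t)^2\,dt.$$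
   Context: The system is the reduced system of an $(N+1)$-link wheeled vehicle whose leading platform (the Chaplygin sleigh) carries a rotor generating the periodic angular momentum $k(t)$. Here $v_1$ is the longitudinal velocity and $\omega$ the angular velocity of the leading platform; $m_i$ and $I_i$ are the mass and the central moment of inertia of the $i$th platform; $a_0$ is the distance from the center of mass of the leading platform to its wheel pair; $c_i$ is the distance from a hinge of the $i$th trailer platform to its wheel pair; $a_i$ ($i\ge1$) is the distance of the center of mass of the $i$th platform from its right hinge. The variables $\theta_i$ are related to the angles $\varphi_i$ between the $i$th trailer platform and the leading platform by $\theta_i=(-1)^{i+1}\varphi_i+2\sum_{j=1}^{i-1}(-1)^{j+1}\varphi_j$; they may be treated as real-valued. The function $\Phi_0$ is everywhere positive. Initial conditions are prescribed at $t=0$. *)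

theory Defs
  imports "HOL-Analysis.Analysis" "HOL-Library.Landau_Symbols"
begin

definition smooth :: "(real \<Rightarrow> real) \<Rightarrow> bool" where
  "smooth f \<longleftrightarrow> (\<forall>n x. (deriv ^^ n) f differentiable (at x))"

definition Phi0 :: "nat \<Rightarrow> real \<Rightarrow> (nat \<Rightarrow> real) \<Rightarrow> (nat \<Rightarrow> real) \<Rightarrow> real" where
  "Phi0 N M \<mu> \<theta> = M + (\<Sum>i=1..N. \<mu> i * (sin (\<theta> i))\<^sup>2)"

definition Phi1 :: "nat \<Rightarrow> (nat \<Rightarrow> real) \<Rightarrow> (nat \<Rightarrow> real) \<Rightarrow> (nat \<Rightarrow> real) \<Rightarrow> real" where
  "Phi1 N \<mu> c \<theta> = (\<Sum>i=1..N. \<mu> i * sin (2 * \<theta> i) *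
     (sin (\<theta> i) / (2 * c i) + (\<Sum>j=1..<i. sin (\<theta> j) / c j)))"

definition Phi2 :: "nat \<Rightarrow> (nat \<Rightarrow> real) \<Rightarrow> (nat \<Rightarrow> real) \<Rightarrow> real" where
  "Phi2 N \<mu> \<theta> = 1 / 2 * (\<Sum>i=1..N. \<mu> i * sin (2 * \<theta> i))"

text \<open>
  Solutions start at time 0 and live on an arbitrary interval \<open>S\<close> of nonnegative times.
  The angle \<open>\<theta>\<^sub>i\<close> at time \<open>t\<close> is \<open>\<theta> t i\<close>; only the indices \<open>1, \<dots>, N\<close> are meaningful.
\<close>

definition is_solution ::
  "nat \<Rightarrow> real \<Rightarrow> real \<Rightarrow> real \<Rightarrow> (nat \<Rightarrow> real) \<Rightarrow> (nat \<Rightarrow> real) \<Rightarrow> (real \<Rightarrow> real) \<Rightarrow>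
   real set \<Rightarrow> (real \<Rightarrow> real) \<Rightarrow> (real \<Rightarrow> real) \<Rightarrow> (real \<Rightarrow> nat \<Rightarrow> real) \<Rightarrow> bool" where
  "is_solution N J b M \<mu> c k S v \<omega> \<theta> \<longleftrightarrow>
     is_interval S \<and> 0 \<in> S \<and> S \<subseteq> {0..} \<and>
     (\<forall>t\<in>S.
        (\<exists>v'. (v has_real_derivative v') (at t within S) \<and>
              Phi0 N M \<mu> (\<theta> t) * v' =
                b * (\<omega> t)\<^sup>2 + Phi1 N \<mu> c (\<theta> t) * (v t)\<^sup>2 + Phi2 N \<mu> (\<theta> t) * \<omega> t * v t) \<and>
        (\<exists>\<omega>'. (\<omega> has_real_derivative \<omega>') (at t within S) \<and>
              J * \<omega>' = - b * \<omega> t * v t - deriv k t) \<and>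
        (\<forall>i\<in>{1..N}. ((\<lambda>s. \<theta> s i) has_real_derivative
              (- (v t / c i) * sin (\<theta> t i) - 2 * (\<Sum>j=1..<i. v t / c j * sin (\<theta> t j)) - \<omega> t))
            (at t within S)))"

text \<open>
  A trajectory is a solution that cannot be continued further forward in time.  Its being
  defined for all nonnegative times is therefore not built into the notion.
\<close>

definition is_trajectory ::
  "nat \<Rightarrow> real \<Rightarrow> real \<Rightarrow> real \<Rightarrow> (nat \<Rightarrow> real) \<Rightarrow> (nat \<Rightarrow> real) \<Rightarrow> (real \<Rightarrow> real) \<Rightarrow>
   real set \<Rightarrow> (real \<Rightarrow> real) \<Rightarrow> (real \<Rightarrow> real) \<Rightarrow> (real \<Rightarrow> nat \<Rightarrow> real) \<Rightarrow> bool" where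
  "is_trajectory N J b M \<mu> c k S v \<omega> \<theta> \<longleftrightarrow>
     is_solution N J b M \<mu> c k S v \<omega> \<theta> \<and>
     (\<forall>S' v' \<omega>' \<theta>'.
        is_solution N J b M \<mu> c k S' v' \<omega>' \<theta>' \<longrightarrow> S \<subseteq> S' \<longrightarrow>
        (\<forall>t\<in>S. v' t = v t \<and> \<omega>' t = \<omega> t \<and> (\<forall>i\<in>{1..N}. \<theta>' t i = \<theta> t i)) \<longrightarrow>
        S' = S)"

end

theory Submission
  imports Defs
begin

text \<open>
  The proof rests on an exact identity. Along solutions, the equations for the angles turn
  \<open>\<Phi>\<^sub>1 v\<^sup>2 + \<Phi>\<^sub>2 \<omega> v\<close> into \<open>- (v / 2) d\<Phi>\<^sub>0/dt\<close>, so \<open>u = v \<surd>\<Phi>\<^sub>0\<close> satisfies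
  \<open>u' = b \<omega>\<^sup>2 / \<surd>\<Phi>\<^sub>0\<close> (lemma \<open>u_deriv\<close>). Since \<open>\<Phi>\<^sub>0\<close> lies between two positive constants, \<open>u\<close> and
  \<open>v\<close> control each other, \<open>u\<close> never decreases, and a large \<open>v\<close> stays large.

  \<^bold>\<open>Global existence.\<close> With \<open>v\<close> bounded away from 0 the equation for \<open>\<omega>\<close> is dissipative, so \<open>\<omega>\<close> stays
  bounded and \<open>u\<close> grows at most linearly. On a bounded time interval \<open>v\<close> and \<open>\<omega>\<close> therefore stay in a
  bounded region. There the system agrees with one whose right-hand side is globally Lipschitz; the
  latter has solutions by Picard iteration (\<open>picard_lindeloef_global\<close>), they are unique, and so a
  solution defined on a bounded interval only is never maximal (\<open>bounded_solution_extends\<close>). The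
  angles are kept small by barriers \<open>\<bar>\<theta>\<^sub>i\<bar> \<le> r\<^sub>i\<close> (\<open>\<theta>_bound\<close>).

  \<^bold>\<open>Divergence of the velocity.\<close> If \<open>u\<close> were bounded, it would converge, hence \<open>\<omega> \<rightarrow> 0\<close>, because \<open>\<omega>\<close> has a
  bounded derivative and \<open>u' \<ge> const \<omega>\<^sup>2\<close>. But then \<open>J \<omega> + k\<close>, whose derivative is \<open>- b \<omega> v\<close>, would be
  asymptotically constant on every bounded window, and the periodic function \<open>k\<close> would be constant
  (\<open>u_at_top\<close>).

  \<^bold>\<open>Fast variables.\<close> All other variables obey equations \<open>y' = v (\<delta> - \<gamma> y)\<close> with \<open>v \<rightarrow> \<infinity>\<close>, \<open>\<gamma>\<close> bounded
  below by a positive constant and \<open>\<delta> \<rightarrow> 0\<close>, and such a \<open>y\<close> tends to 0 (\<open>fast_relaxation\<close>). This is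
  applied in turn to \<open>\<omega>\<close>, to \<open>sin \<theta>\<^sub>i\<close>, to \<open>b v \<omega> + k'\<close> and, by induction on \<open>i\<close>, to
  \<open>v\<^sup>2 sin \<theta>\<^sub>i - (-1)\<^sup>i\<^sup>+\<^sup>1 c\<^sub>i k' / b\<close>.

  \<^bold>\<open>Growth law.\<close> Now \<open>(u\<^sup>3)' = 3 b \<surd>\<Phi>\<^sub>0 (v \<omega>)\<^sup>2\<close> differs from \<open>(3 \<surd>M / b) k'\<^sup>2\<close> by a null function.
  Averaging over time gives \<open>v\<^sup>3 / t \<rightarrow> \<Delta>\<close>, and substituting this into \<open>v \<omega> + k' / b \<rightarrow> 0\<close> and into the
  limit for \<open>v\<^sup>2 \<theta>\<^sub>i\<close> gives the three asymptotic formulas.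
\<close>

section \<open>Barriers and fast relaxation\<close>

text \<open>
  A differentiable function cannot climb through the band between \<open>r\<close> and \<open>R\<close> if it does not
  increase there. The band is finite because the restoring force on an angle fades near \<open>\<pi>\<close>, so that
  the sign of the derivative of an angle is known only close to the barrier.
\<close>

lemma barrier:
  fixes y y' :: "real \<Rightarrow> real"
  assumes der: "\<And>s. s \<in> {a..t} \<Longrightarrow> (y has_real_derivative y' s) (at s within {a..t})"
    and at: "a \<le> t" and init: "y a \<le> r" and rR: "r < R"
    and dec: "\<And>s. s \<in> {a..t} \<Longrightarrow> r < y s \<Longrightarrow> y s < R \<Longrightarrow> y' s \<le> 0"
  shows "y t \<le> r"
proof (rule ccontr)
  assume neg: "\<not> y t \<le> r"
  \<comment> \<open>An intermediate level: up to the first time \<open>t2\<close> at which it is reached, \<open>y\<close> stays below \<open>R\<close>.\<close>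
  define R' where "R' = min (y t) ((r + R) / 2)"
  have R': "r < R'" "R' < R" "R' \<le> y t" using neg rR by (auto simp: R'_def min_def)
  have cont: "continuous_on {a..t} y"
    using der by (meson DERIV_continuous continuous_on_eq_continuous_within)
  have "compact ({a..t} \<inter> y -` {R'..})"
    using continuous_closed_preimage[OF cont closed_real_atLeastAtMost closed_atLeast[of R']]
    by (meson bounded_Int bounded_closed_interval compact_eq_bounded_closed)
  then obtain t2 where t2: "t2 \<in> {a..t}" "R' \<le> y t2" "\<And>s. s \<in> {a..t} \<Longrightarrow> R' \<le> y s \<Longrightarrow> t2 \<le> s"
    using compact_attains_inf[of "{a..t} \<inter> y -` {R'..}"] at R'(3) by fastforce
  have cont2: "continuous_on {a..t2} y" using cont t2 continuous_on_subset by fastforce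
  have "compact ({a..t2} \<inter> y -` {..r})"
    using continuous_closed_preimage[OF cont2 closed_real_atLeastAtMost closed_atMost[of r]]
    by (meson bounded_Int bounded_closed_interval compact_eq_bounded_closed)
  then obtain \<tau> where \<tau>: "\<tau> \<in> {a..t2}" "y \<tau> \<le> r" "\<And>s. s \<in> {a..t2} \<Longrightarrow> y s \<le> r \<Longrightarrow> s \<le> \<tau>"
    using compact_attains_sup[of "{a..t2} \<inter> y -` {..r}"] init t2(1) by fastforce
  have "\<tau> < t2" using \<tau> t2 R' by (metis atLeastAtMost_iff less_eq_real_def not_less order.trans)
  moreover have "\<exists>D. (y has_real_derivative D) (at s) \<and> D \<le> 0" if s: "\<tau> < s" "s < t2" for s
  proof -
    have "s \<in> interior {a..t}" using s \<tau>(1) t2(1) by auto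
    then have "(y has_real_derivative y' s) (at s)"
      using der[of s] at_within_interior[of s "{a..t}"] interior_subset by fastforce
    moreover have "r < y s" "y s < R'"
      using \<tau>(3)[of s] t2(3)[of s] s \<tau>(1) t2(1) by force+
    ultimately show ?thesis using dec[of s] R' s \<tau>(1) t2(1) by force
  qed
  moreover have "continuous_on {\<tau>..t2} y"
    using cont2 \<tau>(1) continuous_on_subset by fastforce
  ultimately have "y t2 \<le> y \<tau>"
    by (intro DERIV_nonpos_imp_decreasing_open[of \<tau> t2 y]) auto
  then show False using t2 \<tau> R' by linarith
qed

lemma abs_barrier:
  fixes y y' :: "real \<Rightarrow> real"
  assumes der: "\<And>s. s \<in> {a..t} \<Longrightarrow> (y has_real_derivative y' s) (at s within {a..t})"
    and at: "a \<le> t" and init: "\<bar>y a\<bar> \<le> r" and rR: "r < R"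
    and dec: "\<And>s. s \<in> {a..t} \<Longrightarrow> r < \<bar>y s\<bar> \<Longrightarrow> \<bar>y s\<bar> < R \<Longrightarrow> y s * y' s \<le> 0"
  shows "\<bar>y t\<bar> \<le> r"
proof -
  have r0: "0 \<le> r" using init by linarith
  have "(y t)\<^sup>2 \<le> r\<^sup>2"
  proof (rule barrier[where y = "\<lambda>s. (y s)\<^sup>2" and y' = "\<lambda>s. 2 * (y s * y' s)" and R = "R\<^sup>2"])
    show "((\<lambda>s. (y s)\<^sup>2) has_real_derivative 2 * (y s * y' s)) (at s within {a..t})"
      if "s \<in> {a..t}" for s
      by (rule derivative_eq_intros der that)+ simp
    show "2 * (y s * y' s) \<le> 0" if "s \<in> {a..t}" "r\<^sup>2 < (y s)\<^sup>2" "(y s)\<^sup>2 < R\<^sup>2" for s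
    proof -
      have "r < \<bar>y s\<bar>" "\<bar>y s\<bar> < R"
        using that r0 rR power_less_imp_less_base[of r 2 "\<bar>y s\<bar>"]
          power_less_imp_less_base[of "\<bar>y s\<bar>" 2 R] by auto
      then show ?thesis using dec[of s] that by simp
    qed
  qed (use at abs_le_square_iff[of "y a" r] init rR r0 power_strict_mono[OF rR r0] in auto)
  then show ?thesis using r0 abs_le_square_iff[of "y t" r] by simp
qed

text \<open>
  If \<open>\<delta>\<close> is small compared with \<open>\<gamma>\<^sub>0 \<eta>\<close>, then outside \<open>\<bar>y\<bar> \<le> \<eta>\<close> the square of \<open>y\<close> decreases at a rate
  bounded away from 0. Hence \<open>y\<close> enters that set, and by the barrier argument it remains there.
\<close>

lemma fast_relaxation:
  fixes y v \<gamma> \<delta> :: "real \<Rightarrow> real"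
  assumes der: "eventually (\<lambda>t. (y has_real_derivative v t * (\<delta> t - \<gamma> t * y t)) (at t)) at_top"
    and v: "filterlim v at_top at_top"
    and \<gamma>: "eventually (\<lambda>t. \<gamma>\<^sub>0 \<le> \<gamma> t) at_top" "0 < \<gamma>\<^sub>0"
    and \<delta>: "(\<delta> \<longlongrightarrow> 0) at_top"
  shows "(y \<longlongrightarrow> 0) at_top"
proof (rule tendstoI)
  fix e :: real assume "0 < e"
  define \<eta> where "\<eta> = e / 2"
  have \<eta>: "0 < \<eta>" "\<eta> < e" using \<open>0 < e\<close> by (auto simp: \<eta>_def)
  have "eventually (\<lambda>t. \<bar>\<delta> t\<bar> < \<gamma>\<^sub>0 * \<eta> / 2) at_top"
    using tendstoD[OF \<delta>, of "\<gamma>\<^sub>0 * \<eta> / 2"] \<eta> \<gamma>(2) by simp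
  moreover have "eventually (\<lambda>t. 1 \<le> v t) at_top"
    using v by (simp add: filterlim_at_top)
  ultimately have "eventually (\<lambda>t. (y has_real_derivative v t * (\<delta> t - \<gamma> t * y t)) (at t) \<and>
      \<gamma>\<^sub>0 \<le> \<gamma> t \<and> \<bar>\<delta> t\<bar> < \<gamma>\<^sub>0 * \<eta> / 2 \<and> 1 \<le> v t) at_top"
    using der \<gamma>(1) by eventually_elim auto
  then obtain T where T: "\<And>t. T \<le> t \<Longrightarrow> (y has_real_derivative v t * (\<delta> t - \<gamma> t * y t)) (at t)"
      "\<And>t. T \<le> t \<Longrightarrow> \<gamma>\<^sub>0 \<le> \<gamma> t" "\<And>t. T \<le> t \<Longrightarrow> \<bar>\<delta> t\<bar> < \<gamma>\<^sub>0 * \<eta> / 2"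
      "\<And>t. T \<le> t \<Longrightarrow> 1 \<le> v t"
    unfolding eventually_at_top_linorder by blast
  have key: "y t * (v t * (\<delta> t - \<gamma> t * y t)) \<le> - \<gamma>\<^sub>0 * \<eta>\<^sup>2 / 2" if "T \<le> t" "\<eta> \<le> \<bar>y t\<bar>" for t
  proof -
    have "y t * \<delta> t \<le> \<bar>y t\<bar> * (\<gamma>\<^sub>0 * \<eta> / 2)"
      using mult_left_mono[OF less_imp_le[OF T(3)[OF that(1)]], of "\<bar>y t\<bar>"]
        abs_ge_self[of "y t * \<delta> t"] by (simp add: abs_mult)
    moreover have "\<gamma>\<^sub>0 * (y t)\<^sup>2 \<le> \<gamma> t * (y t)\<^sup>2"
      using T(2)[OF that(1)] by (intro mult_right_mono) auto
    moreover have "\<eta> * \<bar>y t\<bar> \<le> (y t)\<^sup>2" "\<eta>\<^sup>2 \<le> \<eta> * \<bar>y t\<bar>"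
      using mult_right_mono[OF that(2), of "\<bar>y t\<bar>"] mult_left_mono[OF that(2), of \<eta>] \<eta>
      by (auto simp: power2_eq_square)
    then have "\<gamma>\<^sub>0 * (\<eta> * \<bar>y t\<bar>) \<le> \<gamma>\<^sub>0 * (y t)\<^sup>2" "\<gamma>\<^sub>0 * \<eta>\<^sup>2 \<le> \<gamma>\<^sub>0 * (\<eta> * \<bar>y t\<bar>)"
      using \<gamma>(2) by (auto intro: mult_left_mono)
    ultimately have *: "y t * \<delta> t - \<gamma> t * (y t)\<^sup>2 \<le> - \<gamma>\<^sub>0 * \<eta>\<^sup>2 / 2"
      by (simp add: algebra_simps)
    have "v t * (y t * \<delta> t - \<gamma> t * (y t)\<^sup>2) \<le> 1 * (y t * \<delta> t - \<gamma> t * (y t)\<^sup>2)"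
      using T(4)[OF that(1)] * mult_pos_pos[OF \<gamma>(2) zero_less_power[OF \<eta>(1), of 2]]
      by (intro mult_right_mono_neg) auto
    with * show ?thesis by (simp add: algebra_simps power2_eq_square)
  qed
  have "\<exists>t1\<ge>T. \<bar>y t1\<bar> \<le> \<eta>"
  proof (rule ccontr)
    assume "\<not> (\<exists>t1\<ge>T. \<bar>y t1\<bar> \<le> \<eta>)"
    then have big: "\<eta> < \<bar>y t\<bar>" if "T \<le> t" for t using that by (meson not_less)
    define s where "s = (y T)\<^sup>2 / (\<gamma>\<^sub>0 * \<eta>\<^sup>2) + 1"
    have "0 < s" unfolding s_def using \<gamma>(2) \<eta> by (intro add_nonneg_pos) auto
    have "((\<lambda>t. (y t)\<^sup>2) has_real_derivative 2 * (y t * (v t * (\<delta> t - \<gamma> t * y t)))) (at t)"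
      if "T \<le> t" for t
      by (rule derivative_eq_intros T(1)[OF that])+ simp
    then obtain \<xi> where \<xi>: "T < \<xi>" "(y (T + s))\<^sup>2 - (y T)\<^sup>2 = s * (2 * (y \<xi> * (v \<xi> * (\<delta> \<xi> - \<gamma> \<xi> * y \<xi>))))"
      using MVT2[of T "T + s" "\<lambda>t. (y t)\<^sup>2" "\<lambda>t. 2 * (y t * (v t * (\<delta> t - \<gamma> t * y t)))"] \<open>0 < s\<close> by auto
    have "(y (T + s))\<^sup>2 \<le> (y T)\<^sup>2 - s * (\<gamma>\<^sub>0 * \<eta>\<^sup>2)"
      using \<xi>(2) mult_left_mono[OF key[of \<xi>], of "2 * s"] \<xi>(1) big[of \<xi>] \<open>0 < s\<close> by (simp add: algebra_simps)
    also have "\<dots> = - (\<gamma>\<^sub>0 * \<eta>\<^sup>2)" using \<gamma>(2) \<eta> by (simp add: s_def field_simps)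
    finally have "(y (T + s))\<^sup>2 < 0"
      using mult_pos_pos[OF \<gamma>(2) zero_less_power[OF \<eta>(1), of 2]] by linarith
    then show False by simp
  qed
  then obtain t1 where t1: "T \<le> t1" "\<bar>y t1\<bar> \<le> \<eta>" by blast
  have "\<bar>y t\<bar> \<le> \<eta>" if "t1 \<le> t" for t
  proof (rule abs_barrier[of t1 t y, where R = "\<eta> + 1"])
    show "(y has_real_derivative v s * (\<delta> s - \<gamma> s * y s)) (at s within {t1..t})" if "s \<in> {t1..t}" for s
      using T(1)[of s] that t1 has_field_derivative_at_within by force
    show "y s * (v s * (\<delta> s - \<gamma> s * y s)) \<le> 0" if "s \<in> {t1..t}" "\<eta> < \<bar>y s\<bar>" for s
      using order_trans[OF key[of s], of 0] that t1 \<gamma>(2) by simp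
  qed (use that t1 in auto)
  then show "eventually (\<lambda>t. dist (y t) 0 < e) at_top"
    unfolding eventually_at_top_linorder using \<eta> by (intro exI[of _ t1]) fastforce
qed

section \<open>Periodic functions and elementary estimates\<close>

lemma periodic_bounded:
  fixes q :: "real \<Rightarrow> real"
  assumes per: "\<And>t. 0 \<le> t \<Longrightarrow> q (t + P) = q t" and P: "0 < P" and cont: "continuous_on {0..P} q"
  obtains B where "0 < B" "\<And>t. 0 \<le> t \<Longrightarrow> \<bar>q t\<bar> \<le> B"
proof -
  have "bounded (q ` {0..P})" by (intro compact_imp_bounded compact_continuous_image cont) auto
  then obtain B where B: "0 < B" "\<And>t. t \<in> {0..P} \<Longrightarrow> \<bar>q t\<bar> \<le> B"
    unfolding bounded_pos by auto
  have shift: "q (r + real n * P) = q r" if "0 \<le> r" for r n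
  proof (induction n)
    case (Suc n)
    have "q (r + real (Suc n) * P) = q (r + real n * P + P)" by (simp add: algebra_simps)
    then show ?case using per[of "r + real n * P"] Suc that P by simp
  qed simp
  have "\<bar>q t\<bar> \<le> B" if "0 \<le> t" for t
  proof -
    define n where "n = nat \<lfloor>t / P\<rfloor>"
    have n: "real n = of_int \<lfloor>t / P\<rfloor>" using that P by (simp add: n_def)
    have "real n \<le> t / P" "t / P < real n + 1" unfolding n by linarith+
    then have "0 \<le> t - real n * P" "t - real n * P \<le> P" using P by (auto simp: field_simps)
    then show ?thesis using shift[of "t - real n * P" n] B(2)[of "t - real n * P"] by simp
  qed
  with B(1) that show thesis by blast
qed

text \<open>
  After subtraction of its linear part \<open>m t\<close> the primitive of a periodic function is periodic, hence
  bounded, and disappears after division by \<open>t\<close>.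
\<close>

lemma periodic_mean:
  fixes g :: "real \<Rightarrow> real"
  assumes cont: "continuous_on UNIV g" and per: "\<And>t. g (t + P) = g t" and P: "0 < P"
  shows "((\<lambda>t. integral {0..t} g / t) \<longlongrightarrow> integral {0..P} g / P) at_top"
proof -
  define m where "m = integral {0..P} g / P"
  define G where "G t = integral {0..t} g" for t
  have contS: "continuous_on A g" for A using cont continuous_on_subset by blast
  have G': "(G has_real_derivative g t) (at t within {0..})" if "0 \<le> t" for t
  proof -
    have "(G has_real_derivative g t) (at t within {0..t + 1})"
      unfolding G_def using that by (intro integral_has_real_derivative contS) auto
    moreover have "at t within {0..t + 1} = at t within {0..}"
      by (rule at_within_nhd[of t "{..<t + 1}"]) auto
    ultimately show ?thesis by simp
  qed
  have shift: "(\<lambda>t. t + P) ` {0..} \<subseteq> {0..}" using P by auto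
  have "((\<lambda>t. G (t + P) - G t) has_real_derivative 0) (at t within {0..})" if t: "t \<in> {0..}" for t
  proof -
    have "((\<lambda>t. t + P) has_real_derivative 1) (at t within {0..})"
      by (auto intro!: derivative_eq_intros)
    moreover have "(G has_real_derivative g (t + P)) (at (t + P) within (\<lambda>t. t + P) ` {0..})"
      using t P by (intro DERIV_subset[OF G' shift]) auto
    ultimately have "(G \<circ> (\<lambda>t. t + P) has_real_derivative g (t + P) * 1) (at t within {0..})"
      by (intro DERIV_image_chain)
    from DERIV_diff[OF this G'] t show ?thesis by (simp add: per o_def)
  qed
  then obtain C where C: "\<And>t. 0 \<le> t \<Longrightarrow> G (t + P) - G t = C"
    using has_field_derivative_zero_constant[of "{0..}" "\<lambda>t. G (t + P) - G t"] by auto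
  have "C = m * P" using C[of 0] P by (simp add: G_def m_def)
  then have "G (t + P) - m * (t + P) = G t - m * t" if "0 \<le> t" for t
    using C[OF that] by (simp add: algebra_simps)
  moreover have "continuous_on {0..P} (\<lambda>t. G t - m * t)"
    unfolding G_def
    by (intro continuous_intros indefinite_integral_continuous_1 integrable_continuous_interval contS)
  ultimately obtain B where B: "\<And>t. 0 \<le> t \<Longrightarrow> \<bar>G t - m * t\<bar> \<le> B"
    using periodic_bounded[of "\<lambda>t. G t - m * t" P] P by blast
  have "((\<lambda>t. B * inverse t) \<longlongrightarrow> B * 0) (at_top :: real filter)"
    by (intro tendsto_intros tendsto_inverse_0_at_top filterlim_ident)
  then have "((\<lambda>t. B * inverse t) \<longlongrightarrow> 0) (at_top :: real filter)" by simp
  then have "((\<lambda>t. G t / t - m) \<longlongrightarrow> 0) at_top"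
  proof (rule Lim_null_comparison[rotated])
    show "eventually (\<lambda>t. norm (G t / t - m) \<le> B * inverse t) at_top"
      using eventually_gt_at_top[of 0]
    proof eventually_elim
      case (elim t)
      have "G t / t - m = (G t - m * t) * inverse t" using elim by (simp add: field_simps)
      also have "norm \<dots> \<le> B * inverse t"
        unfolding real_norm_def abs_mult using elim B[of t] by (intro mult_mono) auto
      finally show ?case .
    qed
  qed
  then show ?thesis by (simp add: LIM_zero_iff G_def m_def)
qed

lemma tendsto_zero_times_bounded:
  fixes f g :: "real \<Rightarrow> real"
  assumes "(f \<longlongrightarrow> 0) at_top" "\<And>t. 0 \<le> t \<Longrightarrow> \<bar>g t\<bar> \<le> B"
  shows "((\<lambda>t. f t * g t) \<longlongrightarrow> 0) at_top"
proof (rule Lim_null_comparison)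
  show "eventually (\<lambda>t. norm (f t * g t) \<le> \<bar>f t\<bar> * B) at_top"
    using eventually_ge_at_top[of 0]
    by eventually_elim (auto simp: abs_mult intro!: mult_left_mono assms(2))
  have "((\<lambda>t. \<bar>f t\<bar> * B) \<longlongrightarrow> \<bar>0\<bar> * B) at_top" by (intro tendsto_intros assms(1))
  then show "((\<lambda>t. \<bar>f t\<bar> * B) \<longlongrightarrow> 0) at_top" by simp
qed

lemma abs_sin_diff_le: "\<bar>sin x - x\<bar> \<le> \<bar>x\<bar> ^ 3 / 6" for x :: real
proof -
  have "(\<Sum>m<3. sin_coeff m * x ^ m) = x" by (simp add: numeral_3_eq_3 sin_coeff_def)
  moreover have "inverse (fact 3) * \<bar>x\<bar> ^ 3 = \<bar>x\<bar> ^ 3 / 6" by (simp add: fact_numeral)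
  ultimately show ?thesis using Maclaurin_sin_bound[of x 3] by metis
qed

lemma abs_sin_ge_half: "\<bar>x\<bar> / 2 \<le> \<bar>sin x\<bar>" if "\<bar>x\<bar> \<le> 1" for x :: real
proof -
  have "\<bar>x\<bar> ^ 3 \<le> \<bar>x\<bar> * 1"
    using that unfolding power3_eq_cube mult.assoc by (intro mult_left_mono mult_le_one) auto
  then show ?thesis using abs_sin_diff_le[of x] by linarith
qed

text \<open>
  The lower bound on the restoring force in the equation for an angle.
\<close>

lemma mult_sin_ge: "x\<^sup>2 / 2 \<le> x * sin x" if "\<bar>x\<bar> \<le> 1" for x :: real
proof -
  have "0 \<le> x * sin x"
  proof (cases "0 \<le> x")
    case True
    then show ?thesis using that pi_gt3 by (intro mult_nonneg_nonneg sin_ge_zero) auto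
  next
    case False
    then have "0 \<le> sin (- x)" using that pi_gt3 by (intro sin_ge_zero) auto
    then show ?thesis using False by (simp add: mult_nonpos_nonpos)
  qed
  then have "x * sin x = \<bar>x\<bar> * \<bar>sin x\<bar>" using abs_mult[of x "sin x"] by linarith
  moreover have "\<bar>x\<bar> * (\<bar>x\<bar> / 2) \<le> \<bar>x\<bar> * \<bar>sin x\<bar>"
    by (intro mult_left_mono abs_sin_ge_half that) auto
  ultimately show ?thesis by (simp add: power2_eq_square)
qed

lemma cos_ge_half: "1 / 2 \<le> cos x" if "\<bar>x\<bar> \<le> 1" for x :: real
proof -
  have "cos (pi / 3) \<le> cos \<bar>x\<bar>" using that pi_gt3 by (intro cos_monotone_0_pi_le) auto
  then show ?thesis by (simp add: cos_60)
qed

text \<open>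
  This sum produces the alternating sign in the leading term of the angles.
\<close>

lemma alternating_sum: "(-1) ^ (i + 1) + 2 * (\<Sum>j=1..<i. (-1) ^ (j + 1)) = (1 :: real)" if "1 \<le> i"
  using that by (induction i rule: dec_induct) auto

section \<open>Lipschitz systems of differential equations\<close>

text \<open>
  The unknown is a family indexed by a finite set \<open>A\<close>, so that the dimension may depend on a variable.
  The Picard iterates converge uniformly on all of \<open>{0..T}\<close>, without any smallness of \<open>T\<close>: measured with the weight
  \<open>exp (2 K t)\<close>, each integration at least halves their differences.
\<close>

lemma picard_lindeloef_global:
  fixes F :: "real \<Rightarrow> ('i \<Rightarrow> real) \<Rightarrow> 'i \<Rightarrow> real" and x0 :: "'i \<Rightarrow> real"
  assumes A: "finite A" and L: "0 \<le> L"
    and cont: "\<And>x i. i \<in> A \<Longrightarrow> (\<And>j. j \<in> A \<Longrightarrow> continuous_on {0..T} (\<lambda>t. x t j)) \<Longrightarrow>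
      continuous_on {0..T} (\<lambda>t. F t (x t) i)"
    and lip: "\<And>t x y i. t \<in> {0..T} \<Longrightarrow> i \<in> A \<Longrightarrow>
      \<bar>F t x i - F t y i\<bar> \<le> L * (\<Sum>j\<in>A. \<bar>x j - y j\<bar>)"
  obtains x where "\<And>i. x 0 i = x0 i"
    "\<And>t i. t \<in> {0..T} \<Longrightarrow> i \<in> A \<Longrightarrow>
      ((\<lambda>s. x s i) has_real_derivative F t (x t) i) (at t within {0..T})"
proof -
  define X where "X = rec_nat (\<lambda>_. x0) (\<lambda>_ x t i. x0 i + integral {0..t} (\<lambda>s. F s (x s) i))"
  have X0: "X 0 t i = x0 i" for t i by (simp add: X_def)
  have XS: "X (Suc n) t i = x0 i + integral {0..t} (\<lambda>s. F s (X n s) i)" for n t i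
    by (simp add: X_def)
  have contX: "continuous_on {0..T} (\<lambda>t. X n t i)" if "i \<in> A" for n i
    using that
  proof (induction n arbitrary: i)
    case 0 then show ?case by (simp add: X0)
  next
    case (Suc n)
    then show ?case unfolding XS
      by (intro continuous_on_add continuous_on_const indefinite_integral_continuous_1
          integrable_continuous_interval cont) auto
  qed
  have contF: "continuous_on {0..T} (\<lambda>t. F t (X n t) i)" if "i \<in> A" for n i
    using that contX by (intro cont) auto
  \<comment> \<open>The summand 1 makes \<open>K\<close> positive also if \<open>L = 0\<close>.\<close>
  define K where "K = real (card A) * L + 1"
  have K: "0 < K" using L by (simp add: K_def add_nonneg_pos)
  define D where "D n t = (\<Sum>i\<in>A. \<bar>X (Suc n) t i - X n t i\<bar>)" for n t
  have contD: "continuous_on {0..T} (D n)" for n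
    unfolding D_def by (intro continuous_intros contX)
  have "bounded (D 0 ` {0..T})"
    by (intro compact_imp_bounded compact_continuous_image contD) auto
  then obtain C where C: "0 < C" "\<And>t. t \<in> {0..T} \<Longrightarrow> \<bar>D 0 t\<bar> \<le> C"
    unfolding bounded_pos by auto
  have expi: "((\<lambda>s. exp (2 * K * s)) has_integral (exp (2 * K * t) - 1) / (2 * K)) {0..t}"
    if "0 \<le> t" for t
  proof -
    have "((\<lambda>s. exp (2 * K * s)) has_integral exp (2 * K * t) / (2 * K) - exp (2 * K * 0) / (2 * K)) {0..t}"
    proof (rule fundamental_theorem_of_calculus[OF that])
      fix s assume "s \<in> {0..t}"
      show "((\<lambda>s. exp (2 * K * s) / (2 * K)) has_vector_derivative exp (2 * K * s)) (at s within {0..t})"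
        unfolding has_real_derivative_iff_has_vector_derivative[symmetric]
        using K by (auto intro!: derivative_eq_intros)
    qed
    then show ?thesis by (simp add: diff_divide_distrib)
  qed
  have bound: "D n t \<le> C * (1/2) ^ n * exp (2 * K * t)" if "t \<in> {0..T}" for n t
    using that
  proof (induction n arbitrary: t)
    case 0
    have "D 0 t \<le> C * 1" using C(2)[OF 0] by simp
    also have "\<dots> \<le> C * exp (2 * K * t)" using C(1) 0 K by (intro mult_left_mono) auto
    finally show ?case by simp
  next
    case (Suc n)
    let ?B = "L * (C * (1/2) ^ n) * (exp (2 * K * t) / (2 * K))"
    have "\<bar>X (Suc (Suc n)) t i - X (Suc n) t i\<bar> \<le> ?B" if i: "i \<in> A" for i
    proof -
      have int: "(\<lambda>s. F s (X m s) i) integrable_on {0..t}" for m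
        using contF[OF i, of m] Suc.prems
        by (intro integrable_continuous_interval) (auto elim: continuous_on_subset)
      have "\<bar>X (Suc (Suc n)) t i - X (Suc n) t i\<bar>
          = norm (integral {0..t} (\<lambda>s. F s (X (Suc n) s) i - F s (X n s) i))"
        by (simp add: XS[of "Suc n"] XS[of n] integral_diff[OF int int])
      also have "\<dots> \<le> integral {0..t} (\<lambda>s. L * (C * (1/2) ^ n) * exp (2 * K * s))"
      proof (rule integral_norm_bound_integral)
        show "(\<lambda>s. F s (X (Suc n) s) i - F s (X n s) i) integrable_on {0..t}"
          by (intro integrable_diff int)
        show "(\<lambda>s. L * (C * (1/2) ^ n) * exp (2 * K * s)) integrable_on {0..t}"
          by (intro integrable_continuous_interval continuous_intros)
        fix s assume s: "s \<in> {0..t}"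
        then have s': "s \<in> {0..T}" using Suc.prems by auto
        have "norm (F s (X (Suc n) s) i - F s (X n s) i) \<le> L * D n s"
          using lip[OF s' i, of "X (Suc n) s" "X n s"] by (simp add: D_def)
        also have "\<dots> \<le> L * (C * (1/2) ^ n * exp (2 * K * s))"
          by (intro mult_left_mono Suc.IH s' L)
        finally show "norm (F s (X (Suc n) s) i - F s (X n s) i) \<le> L * (C * (1/2) ^ n) * exp (2 * K * s)"
          by (simp only: mult.assoc)
      qed
      also have "\<dots> = L * (C * (1/2) ^ n) * ((exp (2 * K * t) - 1) / (2 * K))"
        using integral_unique[OF expi[of t]] Suc.prems by simp
      also have "\<dots> \<le> ?B"
        using L C K by (intro mult_left_mono divide_right_mono) auto
      finally show ?thesis .
    qed
    then have "D (Suc n) t \<le> real (card A) * ?B"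
      unfolding D_def using sum_bounded_above[of A "\<lambda>i. \<bar>X (Suc (Suc n)) t i - X (Suc n) t i\<bar>" ?B] by simp
    also have "\<dots> = (real (card A) * L / K) * (C * (1/2) ^ Suc n * exp (2 * K * t))"
      by (simp add: mult_ac)
    also have "\<dots> \<le> 1 * (C * (1/2) ^ Suc n * exp (2 * K * t))"
      using K C by (intro mult_right_mono) (auto simp: K_def)
    finally show ?case by simp
  qed
  have ul: "\<exists>g. uniform_limit {0..T} (\<lambda>n t. X n t i) g sequentially" if i: "i \<in> A" for i
  proof -
    have "uniform_limit {0..T} (\<lambda>n t. \<Sum>m<n. X (Suc m) t i - X m t i)
        (\<lambda>t. \<Sum>m. X (Suc m) t i - X m t i) sequentially"
    proof (rule Weierstrass_m_test)
      show "summable (\<lambda>n. C * exp (2 * K * T) * (1/2) ^ n)"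
        by (intro summable_mult summable_geometric) simp
      fix n t assume t: "t \<in> {0..T}"
      have "\<bar>X (Suc n) t i - X n t i\<bar> \<le> D n t"
        unfolding D_def using A i by (intro member_le_sum) auto
      also have "\<dots> \<le> C * (1/2) ^ n * exp (2 * K * t)" by (rule bound[OF t])
      also have "\<dots> \<le> C * (1/2) ^ n * exp (2 * K * T)"
        using t C K by (intro mult_left_mono) auto
      finally show "norm (X (Suc n) t i - X n t i) \<le> C * exp (2 * K * T) * (1/2) ^ n"
        by (simp add: mult_ac)
    qed
    then have "uniform_limit {0..T} (\<lambda>n t. X n t i - x0 i) (\<lambda>t. \<Sum>m. X (Suc m) t i - X m t i) sequentially"
      using sum_lessThan_telescope[of "\<lambda>m. X m _ i"] by (simp add: X0)
    from uniform_limit_add[OF this uniform_limit_const[where c = "\<lambda>_. x0 i"]] show ?thesis by auto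
  qed
  then obtain g where g: "\<And>i. i \<in> A \<Longrightarrow> uniform_limit {0..T} (\<lambda>n t. X n t i) (g i) sequentially"
    by metis
  \<comment> \<open>The limit of the iterates, completed so that the initial values are attained for every index.\<close>
  define Y where "Y t i = (if i \<in> A \<and> t \<noteq> 0 then g i t else x0 i)" for t i
  have Xz: "X n 0 i = x0 i" for n i by (cases n) (auto simp: X0 XS)
  have Yg: "Y t i = g i t" if "t \<in> {0..T}" "i \<in> A" for t i
  proof (cases "t = 0")
    case True
    have "(\<lambda>n. X n 0 i) \<longlonglongrightarrow> g i 0" using tendsto_uniform_limitI[OF g] that True by auto
    then have "g i 0 = x0 i" unfolding Xz using LIMSEQ_const_iff by metis
    then show ?thesis using True by (simp add: Y_def)
  qed (use that in \<open>simp add: Y_def\<close>)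
  have Y: "uniform_limit {0..T} (\<lambda>n t. X n t i) (\<lambda>t. Y t i) sequentially" if "i \<in> A" for i
    using uniform_limit_cong'[of "{0..T}" "\<lambda>n t. X n t i" "\<lambda>n t. X n t i" "\<lambda>t. Y t i" "g i" sequentially]
      Yg g that by simp
  have contY: "continuous_on {0..T} (\<lambda>t. Y t i)" if "i \<in> A" for i
    using uniform_limit_theorem[OF _ Y[OF that]] contX[OF that] by auto
  have contFY: "continuous_on {0..T} (\<lambda>t. F t (Y t) i)" if "i \<in> A" for i
    using that contY by (intro cont) auto
  have ulF: "uniform_limit {0..T} (\<lambda>n t. F t (X n t) i) (\<lambda>t. F t (Y t) i) sequentially"
    if i: "i \<in> A" for i
  proof (rule uniform_limitI)
    fix e :: real assume e: "0 < e"
    have "eventually (\<lambda>n. \<forall>j\<in>A. \<forall>t\<in>{0..T}. dist (X n t j) (Y t j) < e / K) sequentially"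
      using e K by (intro eventually_ball_finite A ballI uniform_limitD[OF Y]) auto
    then show "eventually (\<lambda>n. \<forall>t\<in>{0..T}. dist (F t (X n t) i) (F t (Y t) i) < e) sequentially"
    proof eventually_elim
      case (elim n)
      show ?case
      proof
        fix t assume t: "t \<in> {0..T}"
        have "\<bar>F t (X n t) i - F t (Y t) i\<bar> \<le> L * (\<Sum>j\<in>A. \<bar>X n t j - Y t j\<bar>)"
          by (rule lip[OF t i])
        also have "\<dots> \<le> L * (real (card A) * (e / K))"
          using elim t by (intro mult_left_mono L sum_bounded_above) (force simp: dist_real_def)
        also have "\<dots> < e" using e K by (simp add: K_def field_simps)
        finally show "dist (F t (X n t) i) (F t (Y t) i) < e" by (simp add: dist_real_def)
      qed
    qed
  qed
  have fixpoint: "Y t i = x0 i + integral {0..t} (\<lambda>s. F s (Y s) i)" if t: "t \<in> {0..T}" and i: "i \<in> A" for t i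
  proof -
    have sub: "{0..t} \<subseteq> {0..T}" using t by auto
    obtain I J where IJ: "\<And>n. ((\<lambda>s. F s (X n s) i) has_integral I n) {0..t}"
        "((\<lambda>s. F s (Y s) i) has_integral J) {0..t}" "I \<longlonglongrightarrow> J"
      using uniform_limit_integral[OF uniform_limit_on_subset[OF ulF[OF i] sub]
          continuous_on_subset[OF contF[OF i] sub]] by auto
    have "(\<lambda>n. X (Suc n) t i) \<longlonglongrightarrow> x0 i + J"
      unfolding XS using IJ by (auto simp: integral_unique[OF IJ(1)] intro!: tendsto_intros)
    moreover have "(\<lambda>n. X (Suc n) t i) \<longlonglongrightarrow> Y t i"
      using tendsto_uniform_limitI[OF Y[OF i] t] by (rule LIMSEQ_Suc)
    ultimately show ?thesis using integral_unique[OF IJ(2)] LIMSEQ_unique by metis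
  qed
  show thesis
  proof (rule that[of Y])
    show "Y 0 i = x0 i" for i by (simp add: Y_def)
    fix t i assume t: "t \<in> {0..T}" and i: "i \<in> A"
    have "((\<lambda>s. x0 i + integral {0..s} (\<lambda>s. F s (Y s) i)) has_real_derivative F t (Y t) i) (at t within {0..T})"
      using integral_has_real_derivative[OF contFY[OF i] t] by (auto intro!: derivative_eq_intros)
    then show "((\<lambda>s. Y s i) has_real_derivative F t (Y t) i) (at t within {0..T})"
      by (rule has_field_derivative_transform_within[OF _ zero_less_one t]) (simp add: fixpoint i)
  qed
qed

text \<open>
  The squared distance \<open>E\<close> of two solutions satisfies \<open>E' \<le> K E\<close>, so \<open>exp (- K t) E\<close> does not increase
  from its initial value 0.
\<close>

lemma lipschitz_ode_unique:
  fixes F :: "real \<Rightarrow> ('i \<Rightarrow> real) \<Rightarrow> 'i \<Rightarrow> real"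
  assumes A: "finite A" and L: "0 \<le> L" and T: "0 \<le> T"
    and lip: "\<And>t x y i. t \<in> {0..T} \<Longrightarrow> i \<in> A \<Longrightarrow>
      \<bar>F t x i - F t y i\<bar> \<le> L * (\<Sum>j\<in>A. \<bar>x j - y j\<bar>)"
    and x: "\<And>t i. t \<in> {0..T} \<Longrightarrow> i \<in> A \<Longrightarrow>
      ((\<lambda>s. x s i) has_real_derivative F t (x t) i) (at t within {0..T})"
    and y: "\<And>t i. t \<in> {0..T} \<Longrightarrow> i \<in> A \<Longrightarrow>
      ((\<lambda>s. y s i) has_real_derivative F t (y t) i) (at t within {0..T})"
    and init: "\<And>i. i \<in> A \<Longrightarrow> x 0 i = y 0 i" and i: "i \<in> A"
  shows "x T i = y T i"
proof -
  define E where "E t = (\<Sum>i\<in>A. (x t i - y t i)\<^sup>2)" for t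
  define E' where "E' t = (\<Sum>i\<in>A. 2 * (x t i - y t i) * (F t (x t) i - F t (y t) i))" for t
  define K where "K = 2 * L * real (card A)"
  have E: "(E has_real_derivative E' t) (at t within {0..T})" if "t \<in> {0..T}" for t
    unfolding E_def E'_def
    by (intro DERIV_sum) (auto intro!: derivative_eq_intros x y that)
  have E'_le: "E' t \<le> K * E t" if "t \<in> {0..T}" for t
  proof -
    have "E' t \<le> (\<Sum>i\<in>A. 2 * \<bar>x t i - y t i\<bar> * (L * (\<Sum>j\<in>A. \<bar>x t j - y t j\<bar>)))"
      unfolding E'_def
    proof (rule sum_mono)
      fix i assume "i \<in> A"
      have "2 * (x t i - y t i) * (F t (x t) i - F t (y t) i) \<le> 2 * \<bar>x t i - y t i\<bar> * \<bar>F t (x t) i - F t (y t) i\<bar>"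
        using abs_ge_self[of "(x t i - y t i) * (F t (x t) i - F t (y t) i)"]
        by (simp only: mult.assoc abs_mult mult_le_cancel_left_pos zero_less_numeral)
      also have "\<dots> \<le> 2 * \<bar>x t i - y t i\<bar> * (L * (\<Sum>j\<in>A. \<bar>x t j - y t j\<bar>))"
        by (intro mult_left_mono lip that \<open>i \<in> A\<close>) auto
      finally show "2 * (x t i - y t i) * (F t (x t) i - F t (y t) i) \<le> \<dots>" .
    qed
    also have "\<dots> = 2 * L * (\<Sum>j\<in>A. \<bar>x t j - y t j\<bar>)\<^sup>2"
      by (simp add: power2_eq_square sum_distrib_left sum_distrib_right mult_ac)
    also have "\<dots> \<le> 2 * L * (real (card A) * (\<Sum>j\<in>A. \<bar>x t j - y t j\<bar>\<^sup>2))"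
      using L sum_squared_le_sum_of_squares[of "\<lambda>j. \<bar>x t j - y t j\<bar>" A] 
      by (intro mult_left_mono) (auto simp: mult.commute)
    finally show ?thesis by (simp add: K_def E_def mult_ac)
  qed
  have "exp (- K * T) * E T \<le> 0"
  proof (rule barrier[where y = "\<lambda>t. exp (- K * t) * E t" and y' = "\<lambda>t. exp (- K * t) * (E' t - K * E t)"
        and a = 0 and R = 1])
    show "((\<lambda>t. exp (- K * t) * E t) has_real_derivative exp (- K * t) * (E' t - K * E t)) (at t within {0..T})"
      if "t \<in> {0..T}" for t
      by (auto intro!: derivative_eq_intros E that simp: algebra_simps)
    show "exp (- K * t) * (E' t - K * E t) \<le> 0" if "t \<in> {0..T}" for t
      using E'_le[OF that] by (simp add: mult_le_0_iff)
  qed (use T in \<open>auto simp: E_def init\<close>)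
  then have "E T \<le> 0" by (simp add: mult_le_0_iff)
  then have "E T = 0" unfolding E_def by (simp add: antisym sum_nonneg)
  then show ?thesis using i A by (simp add: E_def sum_nonneg_eq_0_iff)
qed

text \<open>
  Boundedness is part of the notion because only then the Lipschitz property is inherited by products.
\<close>

definition bounded_lipschitz :: "'i set \<Rightarrow> (('i \<Rightarrow> real) \<Rightarrow> real) \<Rightarrow> bool" where
  "bounded_lipschitz A f \<longleftrightarrow>
    (\<exists>L\<ge>0. \<exists>B\<ge>0. \<forall>x y. \<bar>f x - f y\<bar> \<le> L * (\<Sum>j\<in>A. \<bar>x j - y j\<bar>) \<and> \<bar>f x\<bar> \<le> B)"

lemma bounded_lipschitzI:
  assumes "0 \<le> L" "0 \<le> B" "\<And>x y. \<bar>f x - f y\<bar> \<le> L * (\<Sum>j\<in>A. \<bar>x j - y j\<bar>)" "\<And>x. \<bar>f x\<bar> \<le> B"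
  shows "bounded_lipschitz A f"
  using assms unfolding bounded_lipschitz_def by blast

lemma bounded_lipschitzE:
  assumes "bounded_lipschitz A f"
  obtains L B where "0 \<le> L" "0 \<le> B" "\<And>x y. \<bar>f x - f y\<bar> \<le> L * (\<Sum>j\<in>A. \<bar>x j - y j\<bar>)" "\<And>x. \<bar>f x\<bar> \<le> B"
  using assms unfolding bounded_lipschitz_def by metis

lemma bounded_lipschitz_const: "bounded_lipschitz A (\<lambda>_. a)"
  by (rule bounded_lipschitzI[of 0 "\<bar>a\<bar>"]) auto

lemma bounded_lipschitz_coordinate:
  assumes "finite A" "j \<in> A" "0 \<le> L" "\<And>s t. \<bar>g s - g t\<bar> \<le> L * \<bar>s - t\<bar>" "\<And>s. \<bar>g s\<bar> \<le> B"
  shows "bounded_lipschitz A (\<lambda>x. g (x j))"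
proof (rule bounded_lipschitzI[of L B])
  fix x y :: "'a \<Rightarrow> real"
  have "\<bar>x j - y j\<bar> \<le> (\<Sum>j\<in>A. \<bar>x j - y j\<bar>)"
    using assms(1,2) by (intro member_le_sum) auto
  then show "\<bar>g (x j) - g (y j)\<bar> \<le> L * (\<Sum>j\<in>A. \<bar>x j - y j\<bar>)"
    using assms(3) assms(4)[of "x j" "y j"] mult_left_mono order_trans by blast
next
  show "0 \<le> B" using assms(5)[of 0] by linarith
qed (use assms in auto)

lemma bounded_lipschitz_add:
  assumes "bounded_lipschitz A f" "bounded_lipschitz A g"
  shows "bounded_lipschitz A (\<lambda>x. f x + g x)"
proof -
  obtain L B where f: "0 \<le> L" "0 \<le> B" "\<And>x y. \<bar>f x - f y\<bar> \<le> L * (\<Sum>j\<in>A. \<bar>x j - y j\<bar>)" "\<And>x. \<bar>f x\<bar> \<le> B"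
    by (rule bounded_lipschitzE[OF assms(1)]) blast
  obtain L' B' where g: "0 \<le> L'" "0 \<le> B'" "\<And>x y. \<bar>g x - g y\<bar> \<le> L' * (\<Sum>j\<in>A. \<bar>x j - y j\<bar>)" "\<And>x. \<bar>g x\<bar> \<le> B'"
    by (rule bounded_lipschitzE[OF assms(2)]) blast
  show ?thesis
  proof (rule bounded_lipschitzI[of "L + L'" "B + B'"])
    fix x y :: "'a \<Rightarrow> real"
    show "\<bar>f x + g x - (f y + g y)\<bar> \<le> (L + L') * (\<Sum>j\<in>A. \<bar>x j - y j\<bar>)"
      using f(3)[of x y] g(3)[of x y] unfolding distrib_right by linarith
    show "\<bar>f x + g x\<bar> \<le> B + B'" using f(4)[of x] g(4)[of x] by linarith
  qed (use f g in auto)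
qed

lemma bounded_lipschitz_mult:
  assumes "bounded_lipschitz A f" "bounded_lipschitz A g"
  shows "bounded_lipschitz A (\<lambda>x. f x * g x)"
proof -
  obtain L B where f: "0 \<le> L" "0 \<le> B" "\<And>x y. \<bar>f x - f y\<bar> \<le> L * (\<Sum>j\<in>A. \<bar>x j - y j\<bar>)" "\<And>x. \<bar>f x\<bar> \<le> B"
    by (rule bounded_lipschitzE[OF assms(1)]) blast
  obtain L' B' where g: "0 \<le> L'" "0 \<le> B'" "\<And>x y. \<bar>g x - g y\<bar> \<le> L' * (\<Sum>j\<in>A. \<bar>x j - y j\<bar>)" "\<And>x. \<bar>g x\<bar> \<le> B'"
    by (rule bounded_lipschitzE[OF assms(2)]) blast
  show ?thesis
  proof (rule bounded_lipschitzI[of "B * L' + L * B'" "B * B'"])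
    fix x y :: "'a \<Rightarrow> real"
    let ?S = "\<Sum>j\<in>A. \<bar>x j - y j\<bar>"
    have "f x * g x - f y * g y = f x * (g x - g y) + (f x - f y) * g y"
      by (simp add: algebra_simps)
    also have "\<bar>\<dots>\<bar> \<le> \<bar>f x\<bar> * \<bar>g x - g y\<bar> + \<bar>f x - f y\<bar> * \<bar>g y\<bar>"
      using abs_triangle_ineq[of "f x * (g x - g y)" "(f x - f y) * g y"] by (simp only: abs_mult)
    also have "\<dots> \<le> B * (L' * ?S) + (L * ?S) * B'"
      using f g by (intro add_mono mult_mono) (auto intro!: mult_nonneg_nonneg sum_nonneg)
    finally show "\<bar>f x * g x - f y * g y\<bar> \<le> (B * L' + L * B') * ?S"
      by (simp add: algebra_simps)
    show "\<bar>f x * g x\<bar> \<le> B * B'" unfolding abs_mult using f g by (intro mult_mono) auto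
  qed (use f g in auto)
qed

lemma bounded_lipschitz_minus:
  assumes "bounded_lipschitz A f" "bounded_lipschitz A g"
  shows "bounded_lipschitz A (\<lambda>x. f x - g x)"
  using bounded_lipschitz_add[OF assms(1) bounded_lipschitz_mult[OF bounded_lipschitz_const[of A "-1"] assms(2)]]
  by simp

lemma bounded_lipschitz_sum:
  assumes "\<And>i. i \<in> I \<Longrightarrow> bounded_lipschitz A (f i)"
  shows "bounded_lipschitz A (\<lambda>x. \<Sum>i\<in>I. f i x)"
  using assms
  by (induction I rule: infinite_finite_induct)
     (auto intro: bounded_lipschitz_const bounded_lipschitz_add)

lemma bounded_lipschitz_inverse:
  assumes "bounded_lipschitz A f" "0 < \<phi>" "\<And>x. \<phi> \<le> f x"
  shows "bounded_lipschitz A (\<lambda>x. 1 / f x)"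
proof -
  obtain L B where f: "0 \<le> L" "0 \<le> B" "\<And>x y. \<bar>f x - f y\<bar> \<le> L * (\<Sum>j\<in>A. \<bar>x j - y j\<bar>)" "\<And>x. \<bar>f x\<bar> \<le> B"
    by (rule bounded_lipschitzE[OF assms(1)]) blast
  have pos: "0 < f x" for x using assms(2) assms(3)[of x] by linarith
  show ?thesis
  proof (rule bounded_lipschitzI[of "L / \<phi>\<^sup>2" "1 / \<phi>"])
    fix x y :: "'a \<Rightarrow> real"
    let ?S = "\<Sum>j\<in>A. \<bar>x j - y j\<bar>"
    have "1 / f x - 1 / f y = (f y - f x) / (f x * f y)"
      using pos[of x] pos[of y] by (simp add: field_simps)
    also have "\<bar>\<dots>\<bar> = \<bar>f x - f y\<bar> / (f x * f y)"
      using pos[of x] pos[of y] by (simp add: abs_mult abs_minus_commute)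
    also have "\<dots> \<le> (L * ?S) / \<phi>\<^sup>2"
      unfolding power2_eq_square
      using f assms(2) assms(3)[of x] assms(3)[of y]
      by (intro frac_le mult_mono mult_pos_pos mult_nonneg_nonneg sum_nonneg) auto
    finally show "\<bar>1 / f x - 1 / f y\<bar> \<le> L / \<phi>\<^sup>2 * ?S" by simp
    show "\<bar>1 / f x\<bar> \<le> 1 / \<phi>" using pos[of x] assms(2) assms(3)[of x] by (simp add: frac_le)
  qed (use f assms(2) in auto)
qed

lemmas bounded_lipschitz_intros =
  bounded_lipschitz_const bounded_lipschitz_add bounded_lipschitz_mult bounded_lipschitz_minus
  bounded_lipschitz_sum

definition cutoff :: "real \<Rightarrow> real \<Rightarrow> real" where
  "cutoff R s = max (- R) (min R s)"

lemma cutoff_eq: "\<bar>s\<bar> \<le> R \<Longrightarrow> cutoff R s = s"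
  by (auto simp: cutoff_def)

lemma bounded_lipschitz_cutoff:
  assumes "finite A" "j \<in> A"
  shows "bounded_lipschitz A (\<lambda>x. cutoff R (x j))"
  using assms by (intro bounded_lipschitz_coordinate[of A j 1 _ "\<bar>R\<bar>"]) (auto simp: cutoff_def)

lemma bounded_lipschitz_sin:
  assumes "finite A" "j \<in> A"
  shows "bounded_lipschitz A (\<lambda>x. sin (r * x j))"
proof (rule bounded_lipschitz_coordinate[of A j "\<bar>r\<bar>" "\<lambda>s. sin (r * s)" 1])
  fix s t :: real
  have "\<bar>sin (r * s) - sin (r * t)\<bar> = 2 * (\<bar>sin ((r * s - r * t) / 2)\<bar> * \<bar>cos ((r * s + r * t) / 2)\<bar>)"
    unfolding sin_diff_sin by (simp add: abs_mult)
  also have "\<dots> \<le> 2 * (\<bar>(r * s - r * t) / 2\<bar> * 1)"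
    by (intro mult_left_mono mult_mono abs_sin_x_le_abs_x abs_cos_le_one) auto
  also have "\<dots> = \<bar>r\<bar> * \<bar>s - t\<bar>" by (simp add: abs_mult flip: right_diff_distrib)
  finally show "\<bar>sin (r * s) - sin (r * t)\<bar> \<le> \<bar>r\<bar> * \<bar>s - t\<bar>" .
qed (use assms in auto)

section \<open>The reduced system and the continuation of its bounded solutions\<close>

lemma Phi_cong:
  assumes "\<And>i. i \<in> {1..N} \<Longrightarrow> \<theta> i = \<theta>' i"
  shows "Phi0 N M \<mu> \<theta> = Phi0 N M \<mu> \<theta>'" "Phi1 N \<mu> c \<theta> = Phi1 N \<mu> c \<theta>'" "Phi2 N \<mu> \<theta> = Phi2 N \<mu> \<theta>'"
proof -
  show "Phi0 N M \<mu> \<theta> = Phi0 N M \<mu> \<theta>'" "Phi2 N \<mu> \<theta> = Phi2 N \<mu> \<theta>'"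
    using assms by (auto simp: Phi0_def Phi2_def)
  have "(\<Sum>j = 1..<i. sin (\<theta> j) / c j) = (\<Sum>j = 1..<i. sin (\<theta>' j) / c j)" if "i \<in> {1..N}" for i
    using that by (intro sum.cong) (auto simp: assms)
  then show "Phi1 N \<mu> c \<theta> = Phi1 N \<mu> c \<theta>'"
    unfolding Phi1_def by (intro sum.cong refl) (auto simp: assms)
qed

text \<open>
  The masses and moments of inertia enter the analysis through the positive lower bound \<open>\<phi>\<close> of \<open>\<Phi>\<^sub>0\<close>;
  this keeps the reduced system regular and makes \<open>v\<close> comparable with its rescaling by \<open>\<surd>\<Phi>\<^sub>0\<close>.
\<close>

locale vehicle =
  fixes N :: nat and J b M P \<phi> :: real and \<mu> c :: "nat \<Rightarrow> real" and k :: "real \<Rightarrow> real"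
  assumes J: "0 < J" and b: "0 < b" and c: "\<And>i. i \<in> {1..N} \<Longrightarrow> 0 < c i"
    and \<phi>: "0 < \<phi>" and Phi0_ge: "\<And>\<theta>. \<phi> \<le> Phi0 N M \<mu> \<theta>"
    and smooth: "smooth k" and P: "0 < P" and periodic: "\<And>t. k (t + P) = k t"
    and nonconstant: "\<not> (\<exists>C. \<forall>t. k t = C)"
begin

lemma Phi0_pos: "0 < Phi0 N M \<mu> \<theta>"
  using \<phi> Phi0_ge[of \<theta>] by linarith

lemma k_deriv: "(k has_real_derivative deriv k t) (at t)"
  using smooth[unfolded smooth_def, rule_format, of 0 t]
  by (simp add: DERIV_deriv_iff_real_differentiable)

lemma k_deriv2: "(deriv k has_real_derivative deriv (deriv k) t) (at t)"
  using smooth[unfolded smooth_def, rule_format, of 1 t]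
  by (simp add: DERIV_deriv_iff_real_differentiable)

lemma continuous_deriv_k: "continuous_on A (deriv k)"
  using k_deriv2 by (meson DERIV_isCont continuous_at_imp_continuous_on)

lemma continuous_deriv2_k: "continuous_on A (deriv (deriv k))"
proof -
  have "isCont (deriv (deriv k)) t" for t
    using smooth[unfolded smooth_def, rule_format, of 2 t]
    by (simp add: numeral_2_eq_2 differentiable_imp_continuous_within)
  then show ?thesis by (simp add: continuous_at_imp_continuous_on)
qed

lemma periodic_deriv:
  assumes "\<And>t. f (t + P) = f t" "\<And>t. (f has_real_derivative deriv f t) (at t)"
  shows "deriv f (t + P) = deriv f t"
proof -
  have "((\<lambda>t. f (t + P)) has_real_derivative deriv f (t + P)) (at t)"
    using assms(2)[of "t + P"] by (simp add: DERIV_shift)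
  then show ?thesis unfolding assms(1) by (simp add: DERIV_imp_deriv)
qed

lemma periodic_deriv_k: "deriv k (t + P) = deriv k t"
  by (rule periodic_deriv[OF periodic k_deriv])

lemma deriv_k_bounded: obtains K where "0 < K" "\<And>t. 0 \<le> t \<Longrightarrow> \<bar>deriv k t\<bar> \<le> K"
  using periodic_bounded[OF periodic_deriv_k P continuous_deriv_k] by blast

lemma deriv2_k_bounded: obtains K where "0 < K" "\<And>t. 0 \<le> t \<Longrightarrow> \<bar>deriv (deriv k) t\<bar> \<le> K"
  using periodic_bounded[OF periodic_deriv[OF periodic_deriv_k k_deriv2] P continuous_deriv2_k] by blast

text \<open>
  The right-hand side of the reduced system, solved for the derivatives, with both velocities replaced
  by their cut-offs. The coordinates are \<open>v\<close> at index \<open>0\<close>, \<open>\<theta>\<^sub>i\<close> at \<open>i\<close> and \<open>\<omega>\<close> at \<open>N + 1\<close>. The terms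
  are spelled as products, and \<open>1 * x i\<close> is kept, so that they match the closure rules for
  bounded Lipschitz functions literally.
\<close>

definition truncated_field :: "real \<Rightarrow> real \<Rightarrow> (nat \<Rightarrow> real) \<Rightarrow> nat \<Rightarrow> real" where
  "truncated_field R t x i =
    (if i = 0 then
       (b * (cutoff R (x (Suc N)) * cutoff R (x (Suc N)))
         + Phi1 N \<mu> c x * (cutoff R (x 0) * cutoff R (x 0))
         + Phi2 N \<mu> x * cutoff R (x (Suc N)) * cutoff R (x 0)) * (1 / Phi0 N M \<mu> x)
     else if i = Suc N then - b / J * cutoff R (x (Suc N)) * cutoff R (x 0) - deriv k t / J
     else - 1 / c i * cutoff R (x 0) * sin (1 * x i)
         - 2 * (\<Sum>j=1..<i. 1 / c j * cutoff R (x 0) * sin (1 * x j)) - cutoff R (x (Suc N)))"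

lemma truncated_field_simps:
  "truncated_field R t x 0 =
     (b * (cutoff R (x (Suc N)) * cutoff R (x (Suc N)))
       + Phi1 N \<mu> c x * (cutoff R (x 0) * cutoff R (x 0))
       + Phi2 N \<mu> x * cutoff R (x (Suc N)) * cutoff R (x 0)) * (1 / Phi0 N M \<mu> x)"
  "truncated_field R t x (Suc N) = - b / J * cutoff R (x (Suc N)) * cutoff R (x 0) - deriv k t / J"
  "i \<in> {1..N} \<Longrightarrow> truncated_field R t x i = - 1 / c i * cutoff R (x 0) * sin (1 * x i)
     - 2 * (\<Sum>j=1..<i. 1 / c j * cutoff R (x 0) * sin (1 * x j)) - cutoff R (x (Suc N))"
  by (simp_all add: truncated_field_def)

lemma index_cases:
  assumes "i \<in> {0..Suc N}"
  obtains "i = 0" | "i = Suc N" | "i \<in> {1..N}"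
  using assms by fastforce

lemma bounded_lipschitz_Phi:
  shows "bounded_lipschitz {0..Suc N} (Phi0 N M \<mu>)" "bounded_lipschitz {0..Suc N} (Phi1 N \<mu> c)"
    "bounded_lipschitz {0..Suc N} (Phi2 N \<mu>)"
proof -
  have sin: "bounded_lipschitz {0..Suc N} (\<lambda>x. sin (r * x i))" if "i \<in> {1..N}" for i r
    using that by (intro bounded_lipschitz_sin) auto
  have sin1: "bounded_lipschitz {0..Suc N} (\<lambda>x. sin (x i))" if "i \<in> {1..N}" for i
    using sin[OF that, of 1] by simp
  show "bounded_lipschitz {0..Suc N} (Phi0 N M \<mu>)"
    unfolding Phi0_def[abs_def] power2_eq_square by (intro bounded_lipschitz_intros sin1) auto
  show "bounded_lipschitz {0..Suc N} (Phi2 N \<mu>)"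
    unfolding Phi2_def[abs_def] by (intro bounded_lipschitz_intros sin) auto
  have div: "bounded_lipschitz {0..Suc N} (\<lambda>x. sin (x i) / r)" if "i \<in> {1..N}" for i r
    using bounded_lipschitz_mult[OF sin1[OF that] bounded_lipschitz_const[of _ "1 / r"]] by simp
  show "bounded_lipschitz {0..Suc N} (Phi1 N \<mu> c)"
    unfolding Phi1_def[abs_def] by (intro bounded_lipschitz_intros sin div) auto
qed

text \<open>
  The Lipschitz constant does not depend on time because time enters only through an additive term.
\<close>

lemma truncated_field_lipschitz:
  obtains L where "0 \<le> L" "\<And>t x y i. i \<in> {0..Suc N} \<Longrightarrow>
    \<bar>truncated_field R t x i - truncated_field R t y i\<bar> \<le> L * (\<Sum>j=0..Suc N. \<bar>x j - y j\<bar>)"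
proof -
  have cut: "bounded_lipschitz {0..Suc N} (\<lambda>x. cutoff R (x i))" if "i \<in> {0..Suc N}" for i
    using that by (intro bounded_lipschitz_cutoff) auto
  have "bounded_lipschitz {0..Suc N} (\<lambda>x. truncated_field R t x i)" if "i \<in> {0..Suc N}" for t i
    using that
    by (cases rule: index_cases; simp only: truncated_field_simps;
      intro bounded_lipschitz_intros cut bounded_lipschitz_sin bounded_lipschitz_Phi
        bounded_lipschitz_inverse[OF _ \<phi> Phi0_ge]) auto
  then have "\<exists>L\<ge>0. \<forall>x y. \<bar>truncated_field R 0 x i - truncated_field R 0 y i\<bar> \<le> L * (\<Sum>j=0..Suc N. \<bar>x j - y j\<bar>)"
    if "i \<in> {0..Suc N}" for i
    using that unfolding bounded_lipschitz_def by blast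
  then obtain L where L: "\<And>i. i \<in> {0..Suc N} \<Longrightarrow> 0 \<le> L i" "\<And>i x y. i \<in> {0..Suc N} \<Longrightarrow>
      \<bar>truncated_field R 0 x i - truncated_field R 0 y i\<bar> \<le> L i * (\<Sum>j=0..Suc N. \<bar>x j - y j\<bar>)"
    by metis
  show thesis
  proof (rule that[of "\<Sum>i=0..Suc N. L i"])
    show "0 \<le> (\<Sum>i=0..Suc N. L i)" using L(1) by (intro sum_nonneg) auto
    fix t x y i assume i: "i \<in> {0..Suc N}"
    have "truncated_field R t x i - truncated_field R t y i = truncated_field R 0 x i - truncated_field R 0 y i"
      by (simp add: truncated_field_def)
    also have "\<bar>\<dots>\<bar> \<le> L i * (\<Sum>j=0..Suc N. \<bar>x j - y j\<bar>)" by (rule L(2)[OF i])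
    also have "\<dots> \<le> (\<Sum>i=0..Suc N. L i) * (\<Sum>j=0..Suc N. \<bar>x j - y j\<bar>)"
      using i L(1) by (intro mult_right_mono member_le_sum sum_nonneg) auto
    finally show "\<bar>truncated_field R t x i - truncated_field R t y i\<bar> \<le> \<dots>" .
  qed
qed

lemma truncated_field_continuous:
  assumes "i \<in> {0..Suc N}" "\<And>j. j \<in> {0..Suc N} \<Longrightarrow> continuous_on T (\<lambda>t. x t j)"
  shows "continuous_on T (\<lambda>t. truncated_field R t (x t) i)"
proof -
  obtain L where L: "0 \<le> L" "\<And>t x y i. i \<in> {0..Suc N} \<Longrightarrow>
      \<bar>truncated_field R t x i - truncated_field R t y i\<bar> \<le> L * (\<Sum>j=0..Suc N. \<bar>x j - y j\<bar>)"
    by (rule truncated_field_lipschitz) blast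
  have "continuous_on T (\<lambda>t. truncated_field R 0 (x t) i)"
    unfolding continuous_on
  proof
    fix s assume s: "s \<in> T"
    have x: "((\<lambda>t. x t j) \<longlongrightarrow> x s j) (at s within T)" if "j \<in> {0..Suc N}" for j
      using assms(2)[OF that] s by (simp add: continuous_on)
    have "((\<lambda>t. L * (\<Sum>j=0..Suc N. \<bar>x t j - x s j\<bar>)) \<longlongrightarrow> L * (\<Sum>j=0..Suc N. \<bar>x s j - x s j\<bar>)) (at s within T)"
      by (intro tendsto_intros x)
    then have "((\<lambda>t. L * (\<Sum>j=0..Suc N. \<bar>x t j - x s j\<bar>)) \<longlongrightarrow> 0) (at s within T)" by simp
    then have "((\<lambda>t. truncated_field R 0 (x t) i - truncated_field R 0 (x s) i) \<longlongrightarrow> 0) (at s within T)"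
      by (rule Lim_null_comparison[rotated]) (use L(2)[OF assms(1), of 0] in simp)
    then show "((\<lambda>t. truncated_field R 0 (x t) i) \<longlongrightarrow> truncated_field R 0 (x s) i) (at s within T)"
      by (simp add: LIM_zero_iff)
  qed
  moreover have "truncated_field R t (x t) i = truncated_field R 0 (x t) i
      - (if i = Suc N then (deriv k t - deriv k 0) / J else 0)" for t
    by (simp add: truncated_field_def diff_divide_distrib)
  moreover have "continuous_on T (\<lambda>t. if i = Suc N then (deriv k t - deriv k 0) / J else 0)"
    using J by (cases "i = Suc N") (auto intro!: continuous_intros continuous_deriv_k)
  ultimately show ?thesis by (simp only: continuous_on_diff)
qed

definition state :: "(real \<Rightarrow> real) \<Rightarrow> (real \<Rightarrow> real) \<Rightarrow> (real \<Rightarrow> nat \<Rightarrow> real) \<Rightarrow> real \<Rightarrow> nat \<Rightarrow> real" where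
  "state v \<omega> \<theta> t i = (if i = 0 then v t else if i = Suc N then \<omega> t else \<theta> t i)"

lemma is_solution_iff_truncated:
  assumes "\<And>t. t \<in> S \<Longrightarrow> \<bar>v t\<bar> \<le> R" "\<And>t. t \<in> S \<Longrightarrow> \<bar>\<omega> t\<bar> \<le> R"
  shows "is_solution N J b M \<mu> c k S v \<omega> \<theta> \<longleftrightarrow> is_interval S \<and> 0 \<in> S \<and> S \<subseteq> {0..} \<and>
    (\<forall>t\<in>S. \<forall>i\<in>{0..Suc N}. ((\<lambda>s. state v \<omega> \<theta> s i) has_real_derivative
       truncated_field R t (state v \<omega> \<theta> t) i) (at t within S))"
proof -
  have Phi: "Phi0 N M \<mu> (state v \<omega> \<theta> t) = Phi0 N M \<mu> (\<theta> t)" "Phi1 N \<mu> c (state v \<omega> \<theta> t) = Phi1 N \<mu> c (\<theta> t)"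
      "Phi2 N \<mu> (state v \<omega> \<theta> t) = Phi2 N \<mu> (\<theta> t)" for t
    by (rule Phi_cong; simp add: state_def)+
  have split: "(\<forall>i\<in>{0..Suc N}. Q i) \<longleftrightarrow> Q 0 \<and> Q (Suc N) \<and> (\<forall>i\<in>{1..N}. Q i)" for Q
  proof -
    have "{0..Suc N} = insert 0 (insert (Suc N) {1..N})" by auto
    then show ?thesis by simp
  qed
  have "((\<exists>v'. (v has_real_derivative v') (at t within S) \<and>
              Phi0 N M \<mu> (\<theta> t) * v' =
                b * (\<omega> t)\<^sup>2 + Phi1 N \<mu> c (\<theta> t) * (v t)\<^sup>2 + Phi2 N \<mu> (\<theta> t) * \<omega> t * v t) \<and>
        (\<exists>\<omega>'. (\<omega> has_real_derivative \<omega>') (at t within S) \<and>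
              J * \<omega>' = - b * \<omega> t * v t - deriv k t) \<and>
        (\<forall>i\<in>{1..N}. ((\<lambda>s. \<theta> s i) has_real_derivative
              (- (v t / c i) * sin (\<theta> t i) - 2 * (\<Sum>j=1..<i. v t / c j * sin (\<theta> t j)) - \<omega> t))
            (at t within S)))
     \<longleftrightarrow> (\<forall>i\<in>{0..Suc N}. ((\<lambda>s. state v \<omega> \<theta> s i) has_real_derivative
       truncated_field R t (state v \<omega> \<theta> t) i) (at t within S))" (is "?A \<and> ?B \<and> ?C \<longleftrightarrow> ?D")
    if t: "t \<in> S" for t
  proof -
    have cut: "cutoff R (state v \<omega> \<theta> t 0) = v t" "cutoff R (state v \<omega> \<theta> t (Suc N)) = \<omega> t"
      using assms[OF t] by (auto simp: state_def cutoff_eq)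
    have "Phi0 N M \<mu> (\<theta> t) * v' = r \<longleftrightarrow> v' = r * (1 / Phi0 N M \<mu> (\<theta> t))" for v' r
      using Phi0_pos[of "\<theta> t"] by (auto simp: field_simps)
    then have A: "?A \<longleftrightarrow> ((\<lambda>s. state v \<omega> \<theta> s 0) has_real_derivative
        truncated_field R t (state v \<omega> \<theta> t) 0) (at t within S)"
      unfolding truncated_field_def Phi cut by (simp add: state_def power2_eq_square)
    have "J * w' = r \<longleftrightarrow> w' = r / J" for w' r
      using J by (auto simp: field_simps)
    then have B: "?B \<longleftrightarrow> ((\<lambda>s. state v \<omega> \<theta> s (Suc N)) has_real_derivative
        truncated_field R t (state v \<omega> \<theta> t) (Suc N)) (at t within S)"
      unfolding truncated_field_def cut by (simp add: state_def diff_divide_distrib)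
    have "truncated_field R t (state v \<omega> \<theta> t) i =
        - (v t / c i) * sin (\<theta> t i) - 2 * (\<Sum>j=1..<i. v t / c j * sin (\<theta> t j)) - \<omega> t"
      if i: "i \<in> {1..N}" for i
    proof -
      have "(\<Sum>j=1..<i. 1 / c j * v t * sin (1 * state v \<omega> \<theta> t j)) = (\<Sum>j=1..<i. v t / c j * sin (\<theta> t j))"
        using i by (intro sum.cong) (auto simp: state_def)
      then show ?thesis unfolding truncated_field_def cut using i by (simp add: state_def)
    qed
    then have "?C \<longleftrightarrow> (\<forall>i\<in>{1..N}. ((\<lambda>s. state v \<omega> \<theta> s i) has_real_derivative
        truncated_field R t (state v \<omega> \<theta> t) i) (at t within S))"
      by (intro ball_cong refl) (simp add: state_def)
    with A B show ?thesis unfolding split by blast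
  qed
  then show ?thesis
    unfolding is_solution_def by (intro arg_cong2[where f = conj] refl ball_cong)
qed

text \<open>
  A maximal solution cannot live on a bounded time interval while its velocities stay bounded. The
  solution of the truncated system with the same initial data agrees with it as long as it exists, and
  goes a little beyond the end of its interval before the truncation becomes active.
\<close>

lemma bounded_solution_extends:
  assumes traj: "is_trajectory N J b M \<mu> c k S v \<omega> \<theta>" and S: "S \<subseteq> {0..T}"
    and R: "\<And>t. t \<in> S \<Longrightarrow> \<bar>v t\<bar> \<le> R" "\<And>t. t \<in> S \<Longrightarrow> \<bar>\<omega> t\<bar> \<le> R"
  shows False
proof -
  have sol: "is_solution N J b M \<mu> c k S v \<omega> \<theta>" using traj by (simp add: is_trajectory_def)
  \<comment> \<open>Truncation at \<open>R + 1\<close> leaves a margin of 1 for the continuation.\<close>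
  have R': "\<And>t. t \<in> S \<Longrightarrow> \<bar>v t\<bar> \<le> R + 1" "\<And>t. t \<in> S \<Longrightarrow> \<bar>\<omega> t\<bar> \<le> R + 1" using R by force+
  have sol': "\<forall>t\<in>S. \<forall>i\<in>{0..Suc N}. ((\<lambda>s. state v \<omega> \<theta> s i) has_real_derivative
       truncated_field (R + 1) t (state v \<omega> \<theta> t) i) (at t within S)"
    using iffD1[OF is_solution_iff_truncated sol, of "R + 1"] R' by blast
  have X: "((\<lambda>s. state v \<omega> \<theta> s i) has_real_derivative truncated_field (R + 1) t (state v \<omega> \<theta> t) i) (at t within S)"
    if "t \<in> S" "i \<in> {0..Suc N}" for t i
    using sol' that by blast
  have S0: "is_interval S" "0 \<in> S" "S \<subseteq> {0..}" using sol unfolding is_solution_def by blast+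
  have sub: "{0..t} \<subseteq> S" if "t \<in> S" for t
    using S0 that unfolding is_interval_1 by (meson atLeastAtMost_iff subsetI)
  let ?F = "truncated_field (R + 1)"
  let ?x = "state v \<omega> \<theta>"
  obtain L where L: "0 \<le> L" "\<And>t x y i. i \<in> {0..Suc N} \<Longrightarrow>
    \<bar>?F t x i - ?F t y i\<bar> \<le> L * (\<Sum>j=0..Suc N. \<bar>x j - y j\<bar>)"
    by (rule truncated_field_lipschitz) blast
  obtain Y where Y0: "\<And>i. Y 0 i = ?x 0 i" and Y: "\<And>t i. t \<in> {0..T + 1} \<Longrightarrow> i \<in> {0..Suc N} \<Longrightarrow>
      ((\<lambda>s. Y s i) has_real_derivative ?F t (Y t) i) (at t within {0..T + 1})"
  proof (rule picard_lindeloef_global[of "{0..Suc N}" L "T + 1" ?F "?x 0"])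
    show "continuous_on {0..T + 1} (\<lambda>t. ?F t (x t) i)"
      if "i \<in> {0..Suc N}" "\<And>j. j \<in> {0..Suc N} \<Longrightarrow> continuous_on {0..T + 1} (\<lambda>t. x t j)" for x i
      using that by (rule truncated_field_continuous)
  qed (use L in auto)
  have agree: "Y t i = ?x t i" if t: "t \<in> S" and i: "i \<in> {0..Suc N}" for t i
  proof (rule lipschitz_ode_unique[of "{0..Suc N}" L t ?F])
    show "0 \<le> t" using t S0 by auto
    show "((\<lambda>s. Y s i) has_real_derivative ?F s (Y s) i) (at s within {0..t})"
      if "s \<in> {0..t}" "i \<in> {0..Suc N}" for s i
      using that S t by (intro DERIV_subset[OF Y]) auto
    show "((\<lambda>s. ?x s i) has_real_derivative ?F s (?x s) i) (at s within {0..t})"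
      if "s \<in> {0..t}" "i \<in> {0..Suc N}" for s i
      using sub[OF t] that by (intro DERIV_subset[OF X]) auto
    show "\<bar>?F s x i - ?F s y i\<bar> \<le> L * (\<Sum>j\<in>{0..Suc N}. \<bar>x j - y j\<bar>)"
      if "i \<in> {0..Suc N}" for s x y i
      by (rule L(2)[OF that])
  qed (rule finite_atLeastAtMost L(1) Y0 i)+
  have "uniformly_continuous_on {0..T + 1} (\<lambda>t. Y t i)" if "i \<in> {0..Suc N}" for i
    using DERIV_continuous[OF Y[OF _ that]] compact_Icc
    by (intro compact_uniformly_continuous) (simp_all add: continuous_on_eq_continuous_within)
  then have "\<exists>\<delta>>0. \<forall>s\<in>{0..T+1}. \<forall>t\<in>{0..T+1}. dist t s < \<delta> \<longrightarrow> dist (Y t i) (Y s i) < 1"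
    if "i \<in> {0..Suc N}" for i
    using that zero_less_one unfolding uniformly_continuous_on_def by blast
  from this[of 0] this[of "Suc N"] obtain \<delta>1 \<delta>2 where
    \<delta>1: "0 < \<delta>1" "\<And>s t. s \<in> {0..T+1} \<Longrightarrow> t \<in> {0..T+1} \<Longrightarrow> dist t s < \<delta>1 \<Longrightarrow> dist (Y t 0) (Y s 0) < 1" and
    \<delta>2: "0 < \<delta>2" "\<And>s t. s \<in> {0..T+1} \<Longrightarrow> t \<in> {0..T+1} \<Longrightarrow> dist t s < \<delta>2 \<Longrightarrow> dist (Y t (Suc N)) (Y s (Suc N)) < 1"
    by auto
  \<comment> \<open>Within time \<open>\<delta>\<close> neither velocity uses up the margin.\<close>
  define \<delta> where "\<delta> = min 1 (min (\<delta>1 / 2) (\<delta>2 / 2))"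
  have \<delta>: "0 < \<delta>" "\<delta> \<le> 1" "\<delta> < \<delta>1" "\<delta> < \<delta>2" using \<delta>1(1) \<delta>2(1) by (auto simp: \<delta>_def)
  have bdd: "bdd_above S" using S by (meson bdd_above_Icc bdd_above_mono)
  obtain t0 where t0: "t0 \<in> S" "Sup S - \<delta> < t0"
    using less_cSupD[of S "Sup S - \<delta>"] S0(2) \<delta>(1) by auto
  let ?S' = "{0..t0 + \<delta>}"
  have S': "t0 + \<delta> \<le> T + 1" "0 \<le> t0" using S t0(1) \<delta> S0 by force+
  have bound: "\<bar>Y t i\<bar> \<le> R + 1" if t: "t \<in> ?S'" and i: "i = 0 \<or> i = Suc N" for t i
  proof -
    have *: "\<bar>Y s i\<bar> \<le> R" if "s \<in> S" for s
      using agree[OF that, of i] R that i by (auto simp: state_def)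
    show ?thesis
    proof (cases "t \<le> t0")
      case True
      then have "t \<in> S" using sub[OF t0(1)] t by auto
      from *[OF this] show ?thesis by simp
    next
      case False
      then have "dist (Y t i) (Y t0 i) < 1"
        using i \<delta>1(2)[of t0 t] \<delta>2(2)[of t0 t] \<delta> t S' by (auto simp: dist_real_def)
      with *[OF t0(1)] show ?thesis by (auto simp: dist_real_def)
    qed
  qed
  have st: "state (\<lambda>t. Y t 0) (\<lambda>t. Y t (Suc N)) Y = Y" by (intro ext) (simp add: state_def)
  have "is_solution N J b M \<mu> c k ?S' (\<lambda>t. Y t 0) (\<lambda>t. Y t (Suc N)) Y"
  proof (subst is_solution_iff_truncated[of _ _ "R + 1"], goal_cases)
    case 3
    show ?case unfolding st
      using S' \<delta>(1) by (auto simp: is_interval_cc intro!: DERIV_subset[OF Y])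
  qed (use bound in auto)
  moreover have "S \<subseteq> ?S'"
    using cSup_upper[OF _ bdd] t0(2) S0(3) by fastforce
  moreover have "\<forall>t\<in>S. Y t 0 = v t \<and> Y t (Suc N) = \<omega> t \<and> (\<forall>i\<in>{1..N}. Y t i = \<theta> t i)"
    using agree by (auto simp: state_def)
  ultimately have "?S' = S" using traj unfolding is_trajectory_def by blast
  then have "t0 + \<delta> \<le> Sup S" using cSup_upper[OF _ bdd, of "t0 + \<delta>"] S' \<delta>(1) by auto
  then show False using t0(2) by simp
qed

end

section \<open>A priori estimates\<close>

context vehicle
begin

definition Phi_max :: real where
  "Phi_max = M + (\<Sum>i=1..N. \<bar>\<mu> i\<bar>)"

lemma Phi0_le: "Phi0 N M \<mu> x \<le> Phi_max"
proof -
  have "\<mu> i * (sin (x i))\<^sup>2 \<le> \<bar>\<mu> i\<bar>" for i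
  proof -
    have "\<mu> i * (sin (x i))\<^sup>2 \<le> \<bar>\<mu> i\<bar> * 1"
      by (intro mult_mono) (auto simp: abs_square_le_1)
    then show ?thesis by simp
  qed
  then show ?thesis unfolding Phi0_def Phi_max_def by (intro add_left_mono sum_mono)
qed

lemma Phi_max_pos: "0 < Phi_max"
  by (rule less_le_trans[OF Phi0_pos Phi0_le])

end

lemma sum_powers_8: "7 * (\<Sum>j=1..<i. 8 ^ j) = (8 ^ i - 8 :: real)" if "1 \<le> i"
  using that by (induction i rule: dec_induct) auto

locale vehicle_solution = vehicle +
  fixes S :: "real set" and v \<omega> :: "real \<Rightarrow> real" and \<theta> :: "real \<Rightarrow> nat \<Rightarrow> real"
  assumes sol: "is_solution N J b M \<mu> c k S v \<omega> \<theta>" and v0: "0 < v 0"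
begin

text \<open>
  This rescaled velocity is monotone along solutions, which \<open>v\<close> need not be.
\<close>

definition u :: "real \<Rightarrow> real" where
  "u t = v t * sqrt (Phi0 N M \<mu> (\<theta> t))"

lemma S: "is_interval S" "0 \<in> S" "\<And>t. t \<in> S \<Longrightarrow> 0 \<le> t"
  using sol unfolding is_solution_def by auto

lemma S_down: "t \<in> S \<Longrightarrow> {0..t} \<subseteq> S"
  using S unfolding is_interval_1 by (meson atLeastAtMost_iff subsetI)

lemma \<omega>_deriv: "t \<in> S \<Longrightarrow> (\<omega> has_real_derivative (- b * \<omega> t * v t - deriv k t) / J) (at t within S)"
  using sol J unfolding is_solution_def
  by (metis (no_types, lifting) nonzero_mult_div_cancel_left order_less_irrefl)

lemma \<theta>_deriv: "t \<in> S \<Longrightarrow> i \<in> {1..N} \<Longrightarrow> ((\<lambda>s. \<theta> s i) has_real_derivative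
    - (v t / c i) * sin (\<theta> t i) - 2 * (\<Sum>j=1..<i. v t / c j * sin (\<theta> t j)) - \<omega> t) (at t within S)"
  using sol unfolding is_solution_def by blast

lemma v_deriv: "t \<in> S \<Longrightarrow> (v has_real_derivative
    (b * (\<omega> t)\<^sup>2 + Phi1 N \<mu> c (\<theta> t) * (v t)\<^sup>2 + Phi2 N \<mu> (\<theta> t) * \<omega> t * v t) / Phi0 N M \<mu> (\<theta> t))
    (at t within S)"
  using sol Phi0_pos unfolding is_solution_def
  by (metis (no_types, lifting) nonzero_mult_div_cancel_left order_less_irrefl)

text \<open>
  The key identity. The bracket in \<open>\<Phi>\<^sub>1\<close> is, up to the factor \<open>- 2 v\<close>, the angular part of the equation
  for \<open>\<theta>\<^sub>i\<close>; so \<open>\<Phi>\<^sub>1 v\<^sup>2 + \<Phi>\<^sub>2 \<omega> v\<close> equals \<open>- (v / 2) d\<Phi>\<^sub>0/dt\<close>, which is absorbed by the derivative of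
  \<open>\<surd>\<Phi>\<^sub>0\<close>.
\<close>

lemma u_deriv:
  assumes t: "t \<in> S"
  shows "(u has_real_derivative b * (\<omega> t)\<^sup>2 / sqrt (Phi0 N M \<mu> (\<theta> t))) (at t within S)"
proof -
  define d\<theta> where "d\<theta> i = - (v t / c i) * sin (\<theta> t i) - 2 * (\<Sum>j=1..<i. v t / c j * sin (\<theta> t j)) - \<omega> t" for i
  define D where "D = (\<Sum>i=1..N. \<mu> i * (sin (2 * \<theta> t i) * d\<theta> i))"
  define \<Phi> where "\<Phi> = Phi0 N M \<mu> (\<theta> t)"
  have \<Phi>: "0 < \<Phi>" unfolding \<Phi>_def by (rule Phi0_pos)
  have Phi0_deriv: "((\<lambda>s. Phi0 N M \<mu> (\<theta> s)) has_real_derivative D) (at t within S)"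
  proof -
    have "((\<lambda>s. \<mu> i * (sin (\<theta> s i))\<^sup>2) has_real_derivative \<mu> i * (sin (2 * \<theta> t i) * d\<theta> i)) (at t within S)"
      if "i \<in> {1..N}" for i
    proof -
      have "((\<lambda>y. \<mu> i * (sin y)\<^sup>2) has_real_derivative \<mu> i * (2 * sin (\<theta> t i) * cos (\<theta> t i))) (at (\<theta> t i))"
        by (auto intro!: derivative_eq_intros)
      from DERIV_chain'[OF \<theta>_deriv[OF t that, folded d\<theta>_def] this] show ?thesis
        by (simp only: sin_double mult_ac)
    qed
    then have "((\<lambda>s. M + (\<Sum>i=1..N. \<mu> i * (sin (\<theta> s i))\<^sup>2)) has_real_derivative 0 + D) (at t within S)"
      unfolding D_def by (intro DERIV_add DERIV_const DERIV_sum)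
    then show ?thesis by (simp add: Phi0_def)
  qed
  have d\<theta>: "d\<theta> i = - 2 * v t * (sin (\<theta> t i) / (2 * c i) + (\<Sum>j=1..<i. sin (\<theta> t j) / c j)) - \<omega> t" for i
    unfolding d\<theta>_def by (simp add: sum_distrib_left sum_negf[symmetric] algebra_simps)
  have "Phi1 N \<mu> c (\<theta> t) * (v t)\<^sup>2 + Phi2 N \<mu> (\<theta> t) * \<omega> t * v t
      = (\<Sum>i=1..N. - (v t / 2) * (\<mu> i * (sin (2 * \<theta> t i) * d\<theta> i)))"
    unfolding Phi1_def Phi2_def d\<theta> sum_distrib_left sum_distrib_right sum.distrib[symmetric]
    by (intro sum.cong refl) (simp add: field_simps power2_eq_square)
  then have identity: "Phi1 N \<mu> c (\<theta> t) * (v t)\<^sup>2 + Phi2 N \<mu> (\<theta> t) * \<omega> t * v t = - (v t / 2) * D"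
    unfolding D_def sum_distrib_left .
  have eq: "(b * (\<omega> t)\<^sup>2 + Phi1 N \<mu> c (\<theta> t) * (v t)\<^sup>2 + Phi2 N \<mu> (\<theta> t) * \<omega> t * v t) / \<Phi>
      = (b * (\<omega> t)\<^sup>2 - v t / 2 * D) / \<Phi>"
    using identity by simp
  have v: "(v has_real_derivative (b * (\<omega> t)\<^sup>2 - v t / 2 * D) / \<Phi>) (at t within S)"
    using v_deriv[OF t] by (simp only: \<Phi>_def[symmetric] eq)
  define q where "q = sqrt \<Phi>"
  have q: "0 < q" "\<Phi> = q * q" using \<Phi> by (simp_all add: q_def)
  have "inverse (sqrt (Phi0 N M \<mu> (\<theta> t))) / 2 * D = D / (2 * q)"
    by (simp add: q_def \<Phi>_def field_simps)
  with DERIV_chain'[OF Phi0_deriv DERIV_real_sqrt[OF Phi0_pos]]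
  have sq: "((\<lambda>s. sqrt (Phi0 N M \<mu> (\<theta> s))) has_real_derivative D / (2 * q)) (at t within S)"
    by (simp add: mult.commute)
  have "(u has_real_derivative (b * (\<omega> t)\<^sup>2 - v t / 2 * D) / \<Phi> * q + D / (2 * q) * v t) (at t within S)"
    using DERIV_mult[OF v sq] unfolding u_def[abs_def] q_def \<Phi>_def .
  moreover have "(b * (\<omega> t)\<^sup>2 - v t / 2 * D) / \<Phi> * q + D / (2 * q) * v t = b * (\<omega> t)\<^sup>2 / q"
    using q(1) unfolding q(2) by (simp add: field_simps)
  ultimately show ?thesis unfolding q_def \<Phi>_def by simp
qed

lemma u_mono:
  assumes "s \<in> S" "t \<in> S" "s \<le> t"
  shows "u s \<le> u t"
proof -
  have sub: "{s..t} \<subseteq> S" using S_down[OF assms(2)] S(3)[OF assms(1)] by auto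
  have "- u t \<le> - u s"
  proof (rule barrier[where y = "\<lambda>s. - u s" and a = s and t = t and R = "- u s + 1" and y' = "\<lambda>t. - (b * (\<omega> t)\<^sup>2 / sqrt (Phi0 N M \<mu> (\<theta> t)))"])
    show "((\<lambda>s. - u s) has_real_derivative - (b * (\<omega> r)\<^sup>2 / sqrt (Phi0 N M \<mu> (\<theta> r)))) (at r within {s..t})"
      if "r \<in> {s..t}" for r
      using that sub by (intro DERIV_minus DERIV_subset[OF u_deriv sub]) auto
    show "- (b * (\<omega> r)\<^sup>2 / sqrt (Phi0 N M \<mu> (\<theta> r))) \<le> 0" for r
      using b Phi0_pos[of "\<theta> r"] by simp
  qed (use assms in auto)
  then show ?thesis by simp
qed

lemma u_pos: "t \<in> S \<Longrightarrow> 0 < u t"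
  using u_mono[OF S(2), of t] S(3)[of t] mult_pos_pos[OF v0, of "sqrt (Phi0 N M \<mu> (\<theta> 0))"] Phi0_pos[of "\<theta> 0"]
  by (simp add: u_def)

lemma v_eq: "v t = u t / sqrt (Phi0 N M \<mu> (\<theta> t))"
  using Phi0_pos[of "\<theta> t"] by (simp add: u_def)

lemma v_bounds:
  assumes "t \<in> S"
  shows "u t / sqrt Phi_max \<le> v t" "v t \<le> u t / sqrt \<phi>" "0 < v t"
proof -
  have s: "sqrt \<phi> \<le> sqrt (Phi0 N M \<mu> (\<theta> t))" "sqrt (Phi0 N M \<mu> (\<theta> t)) \<le> sqrt Phi_max" "0 < sqrt \<phi>"
    using Phi0_ge[of "\<theta> t"] Phi0_le[of "\<theta> t"] \<phi> by auto
  show "u t / sqrt Phi_max \<le> v t" "v t \<le> u t / sqrt \<phi>" "0 < v t"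
    unfolding v_eq[of t] using u_pos[OF assms] s by (auto intro!: divide_left_mono mult_pos_pos)
qed

lemma v_lower: "t \<in> S \<Longrightarrow> v 0 * sqrt (\<phi> / Phi_max) \<le> v t"
proof -
  assume t: "t \<in> S"
  have "v 0 * sqrt \<phi> \<le> u 0"
    unfolding u_def using v0 Phi0_ge[of "\<theta> 0"] by simp
  also have "\<dots> \<le> u t" using u_mono[OF S(2) t] S(3)[OF t] by simp
  finally have "v 0 * sqrt \<phi> / sqrt Phi_max \<le> u t / sqrt Phi_max"
    using Phi_max_pos by (simp add: divide_right_mono)
  with v_bounds(1)[OF t] show ?thesis by (simp add: real_sqrt_divide)
qed

text \<open>
  Above the level \<open>r\<close> the damping \<open>b v \<omega>\<close> exceeds the forcing \<open>k'\<close>.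
\<close>

lemma \<omega>_bound:
  assumes V: "0 < V" "\<And>t. t \<in> S \<Longrightarrow> V \<le> v t" and K: "\<And>t. 0 \<le> t \<Longrightarrow> \<bar>deriv k t\<bar> \<le> K"
    and r: "\<bar>\<omega> 0\<bar> \<le> r" "K \<le> b * V * r" and t: "t \<in> S"
  shows "\<bar>\<omega> t\<bar> \<le> r"
proof (rule abs_barrier[where y = \<omega> and a = 0 and t = t and R = "r + 1"])
  show "(\<omega> has_real_derivative (- b * \<omega> s * v s - deriv k s) / J) (at s within {0..t})" if "s \<in> {0..t}" for s
    using S_down[OF t] that by (intro DERIV_subset[OF \<omega>_deriv]) auto
  show "\<omega> s * ((- b * \<omega> s * v s - deriv k s) / J) \<le> 0" if s: "s \<in> {0..t}" "r < \<bar>\<omega> s\<bar>" for s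
  proof -
    have vs: "V \<le> v s" using S_down[OF t] s V(2) by auto
    have "- (\<omega> s * deriv k s) \<le> \<bar>\<omega> s\<bar> * \<bar>deriv k s\<bar>"
      using abs_ge_minus_self[of "\<omega> s * deriv k s"] by (simp only: abs_mult)
    also have "\<dots> \<le> \<bar>\<omega> s\<bar> * (b * V * r)"
      using K[of s] r(2) s(1) by (intro mult_left_mono) auto
    also have "\<dots> \<le> \<bar>\<omega> s\<bar> * (b * v s * \<bar>\<omega> s\<bar>)"
      using b V(1) vs s r(1) by (intro mult_left_mono mult_mono) auto
    also have "\<dots> = b * v s * (\<omega> s)\<^sup>2" by (simp add: power2_eq_square)
    finally have "\<omega> s * (- b * \<omega> s * v s - deriv k s) \<le> 0"
      by (simp add: algebra_simps power2_eq_square)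
    then show ?thesis using J by (simp add: divide_le_0_iff)
  qed
qed (use S(3)[OF t] r in auto)

lemma \<omega>_bounded: obtains W where "0 < W" "\<And>t. t \<in> S \<Longrightarrow> \<bar>\<omega> t\<bar> \<le> W"
proof -
  obtain K where K: "0 < K" "\<And>t. 0 \<le> t \<Longrightarrow> \<bar>deriv k t\<bar> \<le> K" by (rule deriv_k_bounded) blast
  define V where "V = v 0 * sqrt (\<phi> / Phi_max)"
  have V: "0 < V" using v0 \<phi> Phi_max_pos by (simp add: V_def)
  define W where "W = max \<bar>\<omega> 0\<bar> (K / (b * V))"
  have pos: "0 < K / (b * V)" using K V b by simp
  have "\<bar>\<omega> t\<bar> \<le> W" if "t \<in> S" for t
  proof (rule \<omega>_bound[OF V _ K(2) _ _ that])
    have "K = b * V * (K / (b * V))" using b V by simp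
    also have "\<dots> \<le> b * V * W" using b V by (intro mult_left_mono) (auto simp: W_def)
    finally show "K \<le> b * V * W" .
  qed (auto simp: W_def V_def v_lower)
  moreover have "0 < W" using pos by (simp add: W_def)
  ultimately show thesis using that by blast
qed

lemma u_growth:
  assumes W: "\<And>t. t \<in> S \<Longrightarrow> \<bar>\<omega> t\<bar> \<le> W" and t: "t \<in> S"
  shows "u t \<le> u 0 + t * (b * W\<^sup>2 / sqrt \<phi>)"
proof -
  have "u t - t * (b * W\<^sup>2 / sqrt \<phi>) \<le> u 0"
  proof (rule barrier[where y = "\<lambda>t. u t - t * (b * W\<^sup>2 / sqrt \<phi>)" and a = 0 and t = t and R = "u 0 + 1" and
        y' = "\<lambda>t. b * (\<omega> t)\<^sup>2 / sqrt (Phi0 N M \<mu> (\<theta> t)) - b * W\<^sup>2 / sqrt \<phi>"])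
    show "((\<lambda>t. u t - t * (b * W\<^sup>2 / sqrt \<phi>)) has_real_derivative
        b * (\<omega> s)\<^sup>2 / sqrt (Phi0 N M \<mu> (\<theta> s)) - b * W\<^sup>2 / sqrt \<phi>) (at s within {0..t})" if "s \<in> {0..t}" for s
    proof -
      have "(u has_real_derivative b * (\<omega> s)\<^sup>2 / sqrt (Phi0 N M \<mu> (\<theta> s))) (at s within {0..t})"
        using S_down[OF t] that by (intro DERIV_subset[OF u_deriv]) auto
      from DERIV_diff[OF this DERIV_cmult_right[OF DERIV_ident]] show ?thesis by (simp only: mult_1)
    qed
    show "b * (\<omega> s)\<^sup>2 / sqrt (Phi0 N M \<mu> (\<theta> s)) - b * W\<^sup>2 / sqrt \<phi> \<le> 0" if "s \<in> {0..t}" for s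
    proof -
      have "(\<omega> s)\<^sup>2 \<le> W\<^sup>2" using W[of s] S_down[OF t] that by (intro abs_le_square_iff[THEN iffD1]) auto
      then show ?thesis using b \<phi> Phi0_ge[of "\<theta> s"] by (auto intro!: frac_le mult_left_mono)
    qed
  qed (use S(3)[OF t] in auto)
  then show ?thesis by simp
qed

text \<open>
  On a bounded interval \<open>\<omega>\<close> is bounded and \<open>u\<close>, hence \<open>v\<close>, grows at most linearly, so that the solution
  can be continued.
\<close>

lemma trajectory_global:
  assumes "is_trajectory N J b M \<mu> c k S v \<omega> \<theta>"
  shows "S = {0..}"
proof -
  have "\<exists>t\<in>S. T < t" for T
  proof (rule ccontr)
    assume "\<not> (\<exists>t\<in>S. T < t)"
    then have T: "t \<le> T" if "t \<in> S" for t using that by (meson not_less)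
    obtain W where W: "0 < W" "\<And>t. t \<in> S \<Longrightarrow> \<bar>\<omega> t\<bar> \<le> W" by (rule \<omega>_bounded) blast
    define C where "C = b * W\<^sup>2 / sqrt \<phi>"
    have C: "0 \<le> C" using b \<phi> by (simp add: C_def)
    define U where "U = (u 0 + T * C) / sqrt \<phi>"
    have "v t \<le> U" if "t \<in> S" for t
    proof -
      have "u t \<le> u 0 + T * C"
        using u_growth[OF W(2) that, folded C_def] mult_right_mono[OF T[OF that] C] by linarith
      then have "u t / sqrt \<phi> \<le> U" unfolding U_def using \<phi> by (intro divide_right_mono) auto
      with v_bounds(2)[OF that] show ?thesis by simp
    qed
    then have "\<bar>v t\<bar> \<le> max U W" "\<bar>\<omega> t\<bar> \<le> max U W" if "t \<in> S" for t
      using v_bounds(3)[OF that] W(2)[OF that] that by (auto simp: le_max_iff_disj)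
    moreover have "S \<subseteq> {0..T}" using S(3) T by auto
    ultimately show False by (intro bounded_solution_extends[OF assms, of T "max U W"])
  qed
  then have "t \<in> S" if "0 \<le> t" for t
    using that S_down by (meson atLeastAtMost_iff less_imp_le subsetD)
  then show ?thesis using S(3) by auto
qed

text \<open>
  Barriers \<open>r\<^sub>i = c\<^sub>i \<delta> 8\<^sup>i\<close> for the angles, by induction on \<open>i\<close>. At the barrier the restoring term is at
  least \<open>v \<delta> 8\<^sup>i / 2\<close>, whereas the earlier angles and \<open>\<omega>\<close> contribute at most
  \<open>v \<delta> (2 (8\<^sup>i - 8) / 7 + 1)\<close>, which is smaller: the geometric growth of the barriers makes each
  angle dominate all the earlier ones.
\<close>

lemma \<theta>_bound:
  assumes \<delta>: "0 < \<delta>" "\<And>i. i \<in> {1..N} \<Longrightarrow> c i * \<delta> * 8 ^ i \<le> 1 / 2"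
    and \<omega>: "\<And>t. t \<in> S \<Longrightarrow> \<bar>\<omega> t\<bar> \<le> \<delta> * v t"
    and init: "\<And>i. i \<in> {1..N} \<Longrightarrow> \<bar>\<theta> 0 i\<bar> \<le> c i * \<delta> * 8 ^ i"
    and "i \<in> {1..N}" "t \<in> S"
  shows "\<bar>\<theta> t i\<bar> \<le> c i * \<delta> * 8 ^ i"
  using assms(5,6)
proof (induction i arbitrary: t rule: less_induct)
  case (less i)
  note i = less.prems(1) and t = less.prems(2)
  let ?d = "\<lambda>s. - (v s / c i) * sin (\<theta> s i) - 2 * (\<Sum>j=1..<i. v s / c j * sin (\<theta> s j)) - \<omega> s"
  show ?case
  proof (rule abs_barrier[where y = "\<lambda>s. \<theta> s i" and a = 0 and t = t and R = 1 and y' = ?d])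
    show "((\<lambda>s. \<theta> s i) has_real_derivative ?d s) (at s within {0..t})" if "s \<in> {0..t}" for s
      using S_down[OF t] that i by (intro DERIV_subset[OF \<theta>_deriv]) auto
    show "\<theta> s i * ?d s \<le> 0" if s: "s \<in> {0..t}" "c i * \<delta> * 8 ^ i < \<bar>\<theta> s i\<bar>" "\<bar>\<theta> s i\<bar> < 1" for s
    proof -
      have sS: "s \<in> S" using S_down[OF t] s by auto
      let ?y = "\<theta> s i" and ?G = "2 * (\<Sum>j=1..<i. v s / c j * sin (\<theta> s j)) + \<omega> s"
      have vs: "0 < v s" by (rule v_bounds(3)[OF sS])
      have "\<bar>v s / c j * sin (\<theta> s j)\<bar> \<le> v s * \<delta> * 8 ^ j" if j: "j \<in> {1..<i}" for j
      proof -
        have cj: "0 < c j" using c i j by auto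
        have "\<bar>v s / c j * sin (\<theta> s j)\<bar> = v s / c j * \<bar>sin (\<theta> s j)\<bar>"
          using vs cj by (simp add: abs_mult)
        also have "\<dots> \<le> v s / c j * (c j * \<delta> * 8 ^ j)"
          using less.IH[of j s] j i sS vs cj abs_sin_x_le_abs_x[of "\<theta> s j"]
          by (intro mult_left_mono) auto
        finally show ?thesis using cj by simp
      qed
      then have "\<bar>\<Sum>j=1..<i. v s / c j * sin (\<theta> s j)\<bar> \<le> (\<Sum>j=1..<i. v s * \<delta> * 8 ^ j)"
        by (intro order_trans[OF sum_abs] sum_mono)
      also have "\<dots> = v s * \<delta> * ((8 ^ i - 8) / 7)"
        using sum_powers_8[of i] i by (simp flip: sum_distrib_left)
      finally have "\<bar>?G\<bar> \<le> 2 * (v s * \<delta> * ((8 ^ i - 8) / 7)) + \<delta> * v s"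
        using \<omega>[OF sS] by linarith
      also have "\<dots> = v s * \<delta> * (2 / 7 * 8 ^ i - 9 / 7)" by (simp add: field_simps)
      also have "\<dots> \<le> v s * \<delta> * (8 ^ i / 2)"
      proof (rule mult_left_mono)
        have "0 < (8 :: real) ^ i" by simp
        then show "2 / 7 * 8 ^ i - 9 / 7 \<le> (8 :: real) ^ i / 2" by linarith
      qed (use vs \<delta>(1) in simp)
      finally have G: "\<bar>?G\<bar> \<le> v s * \<delta> * (8 ^ i / 2)" .
      have ci: "0 < c i" using c i by auto
      have "- (?y * ?G) \<le> \<bar>?y\<bar> * \<bar>?G\<bar>"
        using abs_ge_minus_self[of "?y * ?G"] by (simp only: abs_mult)
      also have "\<dots> \<le> \<bar>?y\<bar> * (v s * \<delta> * (8 ^ i / 2))" by (intro mult_left_mono G) auto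
      also have "\<dots> = v s / c i * (\<bar>?y\<bar> * (c i * \<delta> * 8 ^ i) / 2)" using ci by simp
      also have "\<dots> \<le> v s / c i * (\<bar>?y\<bar> * \<bar>?y\<bar> / 2)"
        using vs ci s(2) by (intro mult_left_mono divide_right_mono) auto
      also have "\<dots> \<le> v s / c i * (?y * sin ?y)"
        using mult_sin_ge[of ?y] s(3) vs ci by (intro mult_left_mono) (auto simp: power2_eq_square)
      finally show ?thesis by (simp add: algebra_simps)
    qed
  qed (use S(3)[OF t] init[OF i] \<delta>(2)[OF i] in auto)
qed

end

section \<open>Unbounded growth of the velocity\<close>

locale global_solution =
  vehicle_solution N J b M P \<phi> \<mu> c k "{0..}" v \<omega> \<theta>
  for N :: nat and J b M P \<phi> :: real and \<mu> c :: "nat \<Rightarrow> real" and k v \<omega> :: "real \<Rightarrow> real"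
    and \<theta> :: "real \<Rightarrow> nat \<Rightarrow> real" +
  assumes \<theta>_le: "\<And>t i. 0 \<le> t \<Longrightarrow> i \<in> {1..N} \<Longrightarrow> \<bar>\<theta> t i\<bar> \<le> 1"
begin

lemma at_within_nonneg: "0 < t \<Longrightarrow> at t within {0..} = at (t :: real)"
  by (rule at_within_interior) (simp add: interior_real_atLeast)

definition accel :: "real \<Rightarrow> real" where
  "accel t = (b * (\<omega> t)\<^sup>2 + Phi1 N \<mu> c (\<theta> t) * (v t)\<^sup>2 + Phi2 N \<mu> (\<theta> t) * \<omega> t * v t) / Phi0 N M \<mu> (\<theta> t)"

lemma derivs:
  assumes "0 < t"
  shows "(v has_real_derivative accel t) (at t)"
    and "(\<omega> has_real_derivative (- b * \<omega> t * v t - deriv k t) / J) (at t)"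
    and "i \<in> {1..N} \<Longrightarrow> ((\<lambda>s. \<theta> s i) has_real_derivative
      - (v t / c i) * sin (\<theta> t i) - 2 * (\<Sum>j=1..<i. v t / c j * sin (\<theta> t j)) - \<omega> t) (at t)"
    and "(u has_real_derivative b * (\<omega> t)\<^sup>2 / sqrt (Phi0 N M \<mu> (\<theta> t))) (at t)"
  using v_deriv[of t] \<omega>_deriv[of t] \<theta>_deriv[of t i] u_deriv[of t] assms
  by (simp_all add: at_within_nonneg accel_def)

lemma k_shift: "k (x + real n * P) = k x"
proof (induction n)
  case (Suc n)
  then show ?case using periodic[of "x + real n * P"] by (simp add: algebra_simps)
qed simp

text \<open>
  Since \<open>\<omega>\<close> has a bounded derivative, each time at which \<open>\<bar>\<omega>\<bar> \<ge> \<eta>\<close> begins an interval of fixed length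
  \<open>d\<close> on which \<open>\<bar>\<omega>\<bar> \<ge> \<eta> / 2\<close>, and over which \<open>u\<close> rises by a fixed amount \<open>\<kappa>\<close>. Close to its supremum \<open>u\<close>
  has no room for that.
\<close>

lemma \<omega>_tendsto_0_if_u_bounded:
  assumes Z: "\<And>t. 0 \<le> t \<Longrightarrow> u t \<le> Z"
  shows "(\<omega> \<longlongrightarrow> 0) at_top"
proof (rule tendstoI)
  fix \<eta> :: real assume \<eta>: "0 < \<eta>"
  obtain K where K: "0 < K" "\<And>t. 0 \<le> t \<Longrightarrow> \<bar>deriv k t\<bar> \<le> K" by (rule deriv_k_bounded) blast
  obtain W where W: "0 < W" "\<And>t. t \<in> {0..} \<Longrightarrow> \<bar>\<omega> t\<bar> \<le> W" by (rule \<omega>_bounded) blast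
  define V where "V = Z / sqrt \<phi>"
  have V: "0 < v t" "v t \<le> V" if "0 \<le> t" for t
  proof -
    show "0 < v t" using v_bounds(3)[of t] that by simp
    have "u t / sqrt \<phi> \<le> V" unfolding V_def using Z[OF that] \<phi> by (intro divide_right_mono) auto
    then show "v t \<le> V" using v_bounds(2)[of t] that by simp
  qed
  have V0: "0 < V" using V[of 0] by linarith
  define C where "C = (b * W * V + K) / J"
  have C: "0 < C" unfolding C_def using b W(1) V0 K(1) J by (intro divide_pos_pos add_pos_pos mult_pos_pos)
  have \<omega>'_le: "\<bar>(- b * \<omega> t * v t - deriv k t) / J\<bar> \<le> C" if "0 \<le> t" for t
  proof -
    have "\<bar>- b * \<omega> t * v t\<bar> \<le> b * W * V"
      unfolding abs_mult using b W(2)[of t] V[OF that] that W(1) by (intro mult_mono) auto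
    then have "\<bar>- b * \<omega> t * v t - deriv k t\<bar> \<le> b * W * V + K" using K(2)[OF that] by linarith
    then show ?thesis unfolding C_def using J by (simp add: divide_right_mono)
  qed
  define d where "d = \<eta> / (2 * C)"
  have d: "0 < d" using \<eta> C by (simp add: d_def)
  define \<kappa> where "\<kappa> = d * (b * (\<eta> / 2)\<^sup>2 / sqrt Phi_max)"
  have \<kappa>: "0 < \<kappa>" unfolding \<kappa>_def using d b \<eta> Phi_max_pos by simp
  have jump: "u t + \<kappa> \<le> u (t + d)" if t: "0 < t" "\<eta> \<le> \<bar>\<omega> t\<bar>" for t
  proof -
    obtain z where z: "t < z" "z < t + d"
      "u (t + d) - u t = (t + d - t) * (b * (\<omega> z)\<^sup>2 / sqrt (Phi0 N M \<mu> (\<theta> z)))"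
      using MVT2[of t "t + d" u "\<lambda>z. b * (\<omega> z)\<^sup>2 / sqrt (Phi0 N M \<mu> (\<theta> z))"] derivs(4) t d by auto
    obtain z' where z': "t < z'" "z' < z"
      "\<omega> z - \<omega> t = (z - t) * ((- b * \<omega> z' * v z' - deriv k z') / J)"
      using MVT2[of t z \<omega> "\<lambda>z. (- b * \<omega> z * v z - deriv k z) / J"] derivs(2) t z by auto
    have "\<bar>\<omega> z - \<omega> t\<bar> \<le> d * C"
      unfolding z'(3) abs_mult using \<omega>'_le[of z'] z z' t d by (intro mult_mono) auto
    also have "\<dots> = \<eta> / 2" using C by (simp add: d_def)
    finally have "\<eta> / 2 \<le> \<bar>\<omega> z\<bar>" using t(2) by linarith
    then have "(\<eta> / 2)\<^sup>2 \<le> (\<omega> z)\<^sup>2" using \<eta> abs_le_square_iff[of "\<eta> / 2" "\<omega> z"] by simp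
    then have "b * (\<eta> / 2)\<^sup>2 / sqrt Phi_max \<le> b * (\<omega> z)\<^sup>2 / sqrt (Phi0 N M \<mu> (\<theta> z))"
      using b Phi0_le[of "\<theta> z"] Phi0_pos[of "\<theta> z"] by (intro frac_le mult_left_mono) auto
    from mult_left_mono[OF this less_imp_le[OF d]] z(3) show ?thesis
      unfolding \<kappa>_def by simp
  qed
  have bdd: "bdd_above (u ` {0..})" using Z by (intro bdd_aboveI[of _ Z]) auto
  obtain T where T: "0 \<le> T" "Sup (u ` {0..}) - \<kappa> < u T"
    using less_cSupD[of "u ` {0..}" "Sup (u ` {0..}) - \<kappa>"] \<kappa> by auto
  have "\<bar>\<omega> t\<bar> < \<eta>" if t: "T + 1 \<le> t" for t
  proof (rule ccontr)
    assume "\<not> \<bar>\<omega> t\<bar> < \<eta>"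
    then have "u t + \<kappa> \<le> u (t + d)" using jump[of t] t T(1) by simp
    moreover have "u T \<le> u t" using u_mono[of T t] t T(1) by simp
    moreover have "u (t + d) \<le> Sup (u ` {0..})" using t T(1) d bdd by (intro cSup_upper) auto
    ultimately show False using T(2) by linarith
  qed
  then show "eventually (\<lambda>t. dist (\<omega> t) 0 < \<eta>) at_top"
    unfolding eventually_at_top_linorder by auto
qed

text \<open>
  If \<open>u\<close> were bounded, then \<open>\<omega> \<rightarrow> 0\<close> and \<open>\<omega> v \<rightarrow> 0\<close>. Comparing \<open>J \<omega> + k\<close>, whose derivative is
  \<open>- b \<omega> v\<close>, at two points far to the right shows that \<open>k\<close> is constant.
\<close>

lemma u_at_top: "filterlim u at_top at_top"
proof (rule ccontr)
  assume "\<not> filterlim u at_top at_top"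
  then obtain Z where Z: "\<not> eventually (\<lambda>t. Z \<le> u t) at_top"
    unfolding filterlim_at_top by blast
  have uZ: "u t \<le> Z" if "0 \<le> t" for t
  proof (rule ccontr)
    assume "\<not> u t \<le> Z"
    then have "Z \<le> u s" if "t \<le> s" for s using u_mono[of t s] that \<open>0 \<le> t\<close> by simp
    then show False using Z eventually_at_top_linorder by blast
  qed
  define V where "V = Z / sqrt \<phi>"
  have V: "0 < v t" "v t \<le> V" if "0 \<le> t" for t
  proof -
    show "0 < v t" using v_bounds(3)[of t] that by simp
    have "u t / sqrt \<phi> \<le> V" unfolding V_def using uZ[OF that] \<phi> by (intro divide_right_mono) auto
    then show "v t \<le> V" using v_bounds(2)[of t] that by simp
  qed
  have V0: "0 < V" using V[of 0] by linarith
  have "k y = k x" if "x < y" for x y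
  proof -
    define Q where "Q = (y - x) * (b * V) + 2 * J"
    have Q: "0 < Q" unfolding Q_def using that b V0 J by (intro add_pos_pos mult_pos_pos) auto
    have "\<bar>k y - k x\<bar> \<le> e * Q" if e: "0 < e" for e
    proof -
      obtain T where T: "\<And>t. T \<le> t \<Longrightarrow> \<bar>\<omega> t\<bar> < e"
        using tendstoD[OF \<omega>_tendsto_0_if_u_bounded[OF uZ] e] unfolding eventually_at_top_linorder by auto
      obtain n where n: "(max T 1 - x) / P < real n" using reals_Archimedean2 by blast
      define x' where "x' = x + real n * P"
      define y' where "y' = y + real n * P"
      have x': "T \<le> x'" "0 < x'" "x' < y'" using n P \<open>x < y\<close> by (auto simp: x'_def y'_def field_simps)
      have "((\<lambda>t. J * \<omega> t + k t) has_real_derivative - b * \<omega> t * v t) (at t)" if "x' \<le> t" for t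
      proof -
        have "0 < t" using that x'(2) by linarith
        then have "((\<lambda>t. J * \<omega> t + k t) has_real_derivative
            J * ((- b * \<omega> t * v t - deriv k t) / J) + deriv k t) (at t)"
          by (intro DERIV_add DERIV_cmult derivs(2) k_deriv)
        then show ?thesis using J by simp
      qed
      then obtain z where z: "x' < z" "z < y'"
        "(J * \<omega> y' + k y') - (J * \<omega> x' + k x') = (y' - x') * (- b * \<omega> z * v z)"
        using MVT2[of x' y' "\<lambda>t. J * \<omega> t + k t" "\<lambda>t. - b * \<omega> t * v t"] x'(3) by auto
      have "\<bar>- b * \<omega> z * v z\<bar> \<le> b * e * V"
        unfolding abs_mult using b T[of z] V[of z] z x' e by (intro mult_mono) auto
      then have "\<bar>(y' - x') * (- b * \<omega> z * v z)\<bar> \<le> (y' - x') * (b * e * V)"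
        unfolding abs_mult[of "y' - x'"] using x'(3) by (intro mult_mono) auto
      moreover have "\<bar>J * \<omega> y'\<bar> \<le> J * e" "\<bar>J * \<omega> x'\<bar> \<le> J * e"
        using J T[of x'] T[of y'] x' by (auto simp: abs_mult)
      ultimately have "\<bar>k y' - k x'\<bar> \<le> (y' - x') * (b * e * V) + 2 * (J * e)"
        using z(3) by linarith
      also have "\<dots> = e * Q" by (simp add: Q_def x'_def y'_def algebra_simps)
      finally show ?thesis by (simp add: x'_def y'_def k_shift)
    qed
    from this[of "\<bar>k y - k x\<bar> / (2 * Q)"] show ?thesis using Q by (cases "k y = k x") auto
  qed
  then have "k t = k 0" for t by (metis linorder_neqE_linordered_idom)
  with nonconstant show False by blast
qed

lemma v_at_top: "filterlim v at_top at_top"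
proof (rule filterlim_at_top_mono)
  show "filterlim (\<lambda>t. 1 / sqrt Phi_max * u t) at_top at_top"
    using Phi_max_pos by (intro filterlim_tendsto_pos_mult_at_top[OF tendsto_const _ u_at_top]) simp
  show "eventually (\<lambda>t. 1 / sqrt Phi_max * u t \<le> v t) at_top"
    using eventually_ge_at_top[of 0] by eventually_elim (use v_bounds(1) in simp)
qed

lemma v_pos: "0 \<le> t \<Longrightarrow> 0 < v t"
  using v_bounds(3)[of t] by simp

lemma inverse_v: "((\<lambda>t. inverse (v t)) \<longlongrightarrow> 0) at_top"
  by (rule tendsto_inverse_0_at_top[OF v_at_top])

lemma \<omega>_tendsto_0: "(\<omega> \<longlongrightarrow> 0) at_top"
proof (rule fast_relaxation[OF _ v_at_top])
  obtain K where K: "0 < K" "\<And>t. 0 \<le> t \<Longrightarrow> \<bar>deriv k t\<bar> \<le> K" by (rule deriv_k_bounded) blast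
  show "eventually (\<lambda>t. (\<omega> has_real_derivative v t * (- (1 / J) * (inverse (v t) * deriv k t) - b / J * \<omega> t)) (at t)) at_top"
    using eventually_gt_at_top[of 0]
  proof eventually_elim
    case (elim t)
    have "(- b * \<omega> t * v t - deriv k t) / J = v t * (- (1 / J) * (inverse (v t) * deriv k t) - b / J * \<omega> t)"
      using v_pos[of t] elim J by (simp add: field_simps)
    with derivs(2)[OF elim] show ?case by simp
  qed
  show "eventually (\<lambda>t. b / J \<le> b / J) at_top" "0 < b / J" using b J by auto
  have "((\<lambda>t. - (1 / J) * (inverse (v t) * deriv k t)) \<longlongrightarrow> - (1 / J) * 0) at_top"
    by (intro tendsto_intros tendsto_zero_times_bounded[OF inverse_v K(2)])
  then show "((\<lambda>t. - (1 / J) * (inverse (v t) * deriv k t)) \<longlongrightarrow> 0) at_top" by simp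
qed

section \<open>Leading order of the fast variables\<close>

lemma sin_\<theta>_deriv:
  assumes "0 < t" "i \<in> {1..N}"
  shows "((\<lambda>s. sin (\<theta> s i)) has_real_derivative
    - cos (\<theta> t i) * v t * (sin (\<theta> t i) / c i + 2 * (\<Sum>j=1..<i. sin (\<theta> t j) / c j) + \<omega> t / v t)) (at t)"
proof -
  have "- (v t / c i) * sin (\<theta> t i) - 2 * (\<Sum>j=1..<i. v t / c j * sin (\<theta> t j)) - \<omega> t
      = - v t * (sin (\<theta> t i) / c i + 2 * (\<Sum>j=1..<i. sin (\<theta> t j) / c j) + \<omega> t / v t)"
    using v_pos[of t] assms(1) by (simp add: algebra_simps sum_distrib_left sum_negf[symmetric])
  with DERIV_chain'[OF derivs(3)[OF assms] DERIV_sin] show ?thesis by (simp add: mult_ac)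
qed

text \<open>
  The earlier angles and \<open>\<omega> / v\<close> act on \<open>sin \<theta>\<^sub>i\<close> as a perturbation that tends to 0 by induction.
\<close>

lemma sin_\<theta>_tendsto_0: "i \<in> {1..N} \<Longrightarrow> ((\<lambda>t. sin (\<theta> t i)) \<longlongrightarrow> 0) at_top"
proof (induction i rule: less_induct)
  case (less i)
  note i = less.prems
  have ci: "0 < c i" using c i by simp
  define q where "q t = 2 * (\<Sum>j=1..<i. sin (\<theta> t j) / c j) + \<omega> t / v t" for t
  have "((\<lambda>t. 2 * (\<Sum>j=1..<i. sin (\<theta> t j) * (1 / c j)) + \<omega> t * inverse (v t)) \<longlongrightarrow>
      2 * (\<Sum>j=1..<i. 0 * (1 / c j)) + 0 * 0) at_top"
    using i by (intro tendsto_intros less.IH \<omega>_tendsto_0 inverse_v) auto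
  then have q: "(q \<longlongrightarrow> 0) at_top" by (simp add: q_def[abs_def] divide_inverse)
  show ?case
  proof (rule fast_relaxation[OF _ v_at_top])
    show "eventually (\<lambda>t. ((\<lambda>s. sin (\<theta> s i)) has_real_derivative
        v t * (q t * - cos (\<theta> t i) - cos (\<theta> t i) / c i * sin (\<theta> t i))) (at t)) at_top"
      using eventually_gt_at_top[of 0]
    proof eventually_elim
      case (elim t)
      show ?case using sin_\<theta>_deriv[OF elim i] by (simp add: q_def algebra_simps)
    qed
    show "eventually (\<lambda>t. 1 / 2 / c i \<le> cos (\<theta> t i) / c i) at_top"
      using eventually_ge_at_top[of 0]
      by eventually_elim (use ci i \<theta>_le in \<open>intro divide_right_mono cos_ge_half, auto\<close>)
    show "0 < 1 / 2 / c i" using ci by simp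
    show "((\<lambda>t. q t * - cos (\<theta> t i)) \<longlongrightarrow> 0) at_top"
      by (rule tendsto_zero_times_bounded[OF q, of _ 1]) simp
  qed
qed

lemma \<theta>_le_sin: "0 \<le> t \<Longrightarrow> i \<in> {1..N} \<Longrightarrow> \<bar>\<theta> t i\<bar> \<le> 2 * \<bar>sin (\<theta> t i)\<bar>"
  using abs_sin_ge_half[OF \<theta>_le[of t i]] by simp

lemma \<theta>_tendsto_0: "i \<in> {1..N} \<Longrightarrow> ((\<lambda>t. \<theta> t i) \<longlongrightarrow> 0) at_top"
proof (rule Lim_null_comparison)
  assume i: "i \<in> {1..N}"
  show "eventually (\<lambda>t. norm (\<theta> t i) \<le> 2 * \<bar>sin (\<theta> t i)\<bar>) at_top"
    using eventually_ge_at_top[of 0] by eventually_elim (use \<theta>_le_sin i in simp)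
  have "((\<lambda>t. 2 * \<bar>sin (\<theta> t i)\<bar>) \<longlongrightarrow> 2 * \<bar>0\<bar>) at_top"
    by (intro tendsto_intros sin_\<theta>_tendsto_0 i)
  then show "((\<lambda>t. 2 * \<bar>sin (\<theta> t i)\<bar>) \<longlongrightarrow> 0) at_top" by simp
qed

lemma Phi_tendsto:
  "((\<lambda>t. Phi0 N M \<mu> (\<theta> t)) \<longlongrightarrow> M) at_top"
  "((\<lambda>t. Phi1 N \<mu> c (\<theta> t)) \<longlongrightarrow> 0) at_top"
  "((\<lambda>t. Phi2 N \<mu> (\<theta> t)) \<longlongrightarrow> 0) at_top"
proof -
  have sin2: "((\<lambda>t. sin (2 * \<theta> t i)) \<longlongrightarrow> 0) at_top" if "i \<in> {1..N}" for i
  proof -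
    have "((\<lambda>t. sin (2 * \<theta> t i)) \<longlongrightarrow> sin (2 * 0)) at_top" by (intro tendsto_intros \<theta>_tendsto_0 that)
    then show ?thesis by simp
  qed
  have "((\<lambda>t. Phi0 N M \<mu> (\<theta> t)) \<longlongrightarrow> M + (\<Sum>i=1..N. \<mu> i * 0\<^sup>2)) at_top"
    unfolding Phi0_def by (intro tendsto_intros sin_\<theta>_tendsto_0)
  then show "((\<lambda>t. Phi0 N M \<mu> (\<theta> t)) \<longlongrightarrow> M) at_top" by simp
  have "((\<lambda>t. Phi2 N \<mu> (\<theta> t)) \<longlongrightarrow> 1 / 2 * (\<Sum>i=1..N. \<mu> i * 0)) at_top"
    unfolding Phi2_def by (intro tendsto_intros sin2)
  then show "((\<lambda>t. Phi2 N \<mu> (\<theta> t)) \<longlongrightarrow> 0) at_top" by simp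
  have "((\<lambda>t. \<Sum>i=1..N. \<mu> i * sin (2 * \<theta> t i) *
       (sin (\<theta> t i) * (1 / (2 * c i)) + (\<Sum>j=1..<i. sin (\<theta> t j) * (1 / c j))))
     \<longlongrightarrow> (\<Sum>i=1..N. \<mu> i * 0 * (0 * (1 / (2 * c i)) + (\<Sum>j=1..<i. 0 * (1 / c j))))) at_top"
    by (intro tendsto_intros sin2 sin_\<theta>_tendsto_0) auto
  then show "((\<lambda>t. Phi1 N \<mu> c (\<theta> t)) \<longlongrightarrow> 0) at_top" by (simp add: Phi1_def)
qed

lemma M_pos: "0 < M"
  using Phi0_pos[of "\<lambda>_. 0"] by (simp add: Phi0_def)

text \<open>
  Acceleration in units of \<open>v\<^sup>2\<close>: differentiating a power of \<open>v\<close> multiplies it by a multiple of \<open>\<rho> v\<close>,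
  which is of lower order than the relaxation rate \<open>v\<close>.
\<close>

definition \<rho> :: "real \<Rightarrow> real" where
  "\<rho> t = accel t / (v t)\<^sup>2"

lemma accel_eq: "0 \<le> t \<Longrightarrow> accel t = \<rho> t * (v t)\<^sup>2"
  using v_pos[of t] by (simp add: \<rho>_def)

lemma \<rho>_tendsto_0: "(\<rho> \<longlongrightarrow> 0) at_top"
proof -
  define w where "w t = \<omega> t * inverse (v t)" for t
  have "(w \<longlongrightarrow> 0 * 0) at_top" unfolding w_def[abs_def] by (intro tendsto_intros \<omega>_tendsto_0 inverse_v)
  then have w: "(w \<longlongrightarrow> 0) at_top" by simp
  have "((\<lambda>t. (b * (w t)\<^sup>2 + Phi1 N \<mu> c (\<theta> t) + Phi2 N \<mu> (\<theta> t) * w t) / Phi0 N M \<mu> (\<theta> t))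
      \<longlongrightarrow> (b * 0\<^sup>2 + 0 + 0 * 0) / M) at_top"
    using M_pos by (intro tendsto_intros w Phi_tendsto) auto
  then have "((\<lambda>t. (b * (w t)\<^sup>2 + Phi1 N \<mu> c (\<theta> t) + Phi2 N \<mu> (\<theta> t) * w t) / Phi0 N M \<mu> (\<theta> t)) \<longlongrightarrow> 0) at_top"
    by simp
  moreover have "eventually (\<lambda>t. (b * (w t)\<^sup>2 + Phi1 N \<mu> c (\<theta> t) + Phi2 N \<mu> (\<theta> t) * w t) / Phi0 N M \<mu> (\<theta> t) = \<rho> t) at_top"
    using eventually_ge_at_top[of 0]
  proof eventually_elim
    case (elim t)
    then have "v t \<noteq> 0" using v_pos[of t] by simp
    then show ?case
      unfolding \<rho>_def accel_def w_def by (simp add: power2_eq_square field_simps)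
  qed
  ultimately show ?thesis by (rule Lim_transform_eventually)
qed

text \<open>
  The defect of the quasi-static balance \<open>b v \<omega> = - k'\<close> in the equation for \<open>\<omega>\<close>.
\<close>

definition defect :: "real \<Rightarrow> real" where
  "defect t = b * v t * \<omega> t + deriv k t"

lemma defect_tendsto_0: "(defect \<longlongrightarrow> 0) at_top"
proof (rule fast_relaxation[OF _ v_at_top])
  obtain K where K: "\<And>t. 0 \<le> t \<Longrightarrow> \<bar>deriv k t\<bar> \<le> K" by (rule deriv_k_bounded) blast
  obtain K' where K': "\<And>t. 0 \<le> t \<Longrightarrow> \<bar>deriv (deriv k) t\<bar> \<le> K'" by (rule deriv2_k_bounded) blast
  let ?\<delta> = "\<lambda>t. - (\<rho> t * deriv k t) + inverse (v t) * deriv (deriv k) t"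
  show "eventually (\<lambda>t. (defect has_real_derivative v t * (?\<delta> t - (b / J - \<rho> t) * defect t)) (at t)) at_top"
    using eventually_gt_at_top[of 0]
  proof eventually_elim
    case (elim t)
    have v: "v t \<noteq> 0" using v_pos[of t] elim by simp
    have "((\<lambda>t. b * v t * \<omega> t) has_real_derivative
        b * accel t * \<omega> t + (- b * \<omega> t * v t - deriv k t) / J * (b * v t)) (at t)"
      by (intro DERIV_mult DERIV_cmult derivs elim)
    then have "(defect has_real_derivative
        b * accel t * \<omega> t + (- b * \<omega> t * v t - deriv k t) / J * (b * v t) + deriv (deriv k) t) (at t)"
      unfolding defect_def[abs_def] by (intro DERIV_add k_deriv2)
    moreover have "b * accel t * \<omega> t + (- b * \<omega> t * v t - deriv k t) / J * (b * v t) + deriv (deriv k) t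
        = v t * (?\<delta> t - (b / J - \<rho> t) * defect t)"
      using v J elim unfolding defect_def accel_eq[OF less_imp_le[OF elim]]
      by (simp add: field_simps power2_eq_square)
    ultimately show ?case by simp
  qed
  have half: "x / 2 < x - 0" if "0 < x" for x :: real using that by simp
  have "((\<lambda>t. b / J - \<rho> t) \<longlongrightarrow> b / J - 0) at_top" by (intro tendsto_intros \<rho>_tendsto_0)
  then have "eventually (\<lambda>t. b / J / 2 < b / J - \<rho> t) at_top"
    by (rule order_tendstoD(1)[OF _ half[OF divide_pos_pos[OF b J]]])
  then show "eventually (\<lambda>t. b / J / 2 \<le> b / J - \<rho> t) at_top" by eventually_elim simp
  show "0 < b / J / 2" using b J by simp
  have "(?\<delta> \<longlongrightarrow> - 0 + 0) at_top"
    by (intro tendsto_intros tendsto_zero_times_bounded[OF \<rho>_tendsto_0 K] tendsto_zero_times_bounded[OF inverse_v K'])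
  then show "(?\<delta> \<longlongrightarrow> 0) at_top" by simp
qed

text \<open>
  The expected limiting profile of \<open>v\<^sup>2 \<theta>\<^sub>i\<close>.
\<close>

definition \<xi> :: "nat \<Rightarrow> real \<Rightarrow> real" where
  "\<xi> i t = (-1) ^ (i + 1) * (c i * deriv k t / b)"

text \<open>
  The profiles solve the linearised quasi-static equations for the angles, with \<open>v \<omega>\<close> replaced by its
  leading term \<open>- k' / b\<close>.
\<close>

lemma \<xi>_balance:
  assumes "i \<in> {1..N}"
  shows "\<xi> i t / c i + 2 * (\<Sum>j=1..<i. \<xi> j t / c j) = deriv k t / b"
proof -
  have \<xi>: "\<xi> j t / c j = (-1) ^ (j + 1) * (deriv k t / b)" if "j \<in> {1..N}" for j
    using c[OF that] by (simp add: \<xi>_def)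
  have "(\<Sum>j=1..<i. \<xi> j t / c j) = (\<Sum>j=1..<i. (-1) ^ (j + 1)) * (deriv k t / b)"
    unfolding sum_distrib_right using assms by (intro sum.cong \<xi> refl) auto
  then have "\<xi> i t / c i + 2 * (\<Sum>j=1..<i. \<xi> j t / c j)
      = ((-1) ^ (i + 1) + 2 * (\<Sum>j=1..<i. (-1) ^ (j + 1))) * (deriv k t / b)"
    using \<xi>[OF assms] by (simp only: distrib_right mult.assoc)
  then show ?thesis using alternating_sum[of i] assms by simp
qed

lemma \<xi>_bounded:
  obtains B where "\<And>t. 0 \<le> t \<Longrightarrow> \<bar>\<xi> i t\<bar> \<le> B"
proof -
  obtain K where K: "\<And>t. 0 \<le> t \<Longrightarrow> \<bar>deriv k t\<bar> \<le> K" by (rule deriv_k_bounded) blast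
  have "\<bar>\<xi> i t\<bar> \<le> \<bar>c i\<bar> * K / \<bar>b\<bar>" if "0 \<le> t" for t
    unfolding \<xi>_def using K[OF that] b by (simp add: abs_mult power_abs mult_left_mono divide_right_mono)
  then show thesis by (rule that)
qed

definition \<zeta> :: "nat \<Rightarrow> real \<Rightarrow> real" where
  "\<zeta> i t = (v t)\<^sup>2 * sin (\<theta> t i) - \<xi> i t"

text \<open>
  By the balance of the profiles the equation for the error \<open>\<zeta>\<^sub>i\<close> contains only the errors of the
  earlier angles, the defect of the balance for \<open>\<omega>\<close>, and terms with a factor \<open>\<rho>\<close> or \<open>1 / v\<close>.
\<close>

lemma \<zeta>_tendsto_0: "i \<in> {1..N} \<Longrightarrow> (\<zeta> i \<longlongrightarrow> 0) at_top"
proof (induction i rule: less_induct)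
  case (less i)
  note i = less.prems
  have ci: "0 < c i" using c i by simp
  obtain B where B: "\<And>t. 0 \<le> t \<Longrightarrow> \<bar>\<xi> i t\<bar> \<le> B" by (rule \<xi>_bounded) blast
  obtain K' where K': "\<And>t. 0 \<le> t \<Longrightarrow> \<bar>deriv (deriv k) t\<bar> \<le> K'" by (rule deriv2_k_bounded) blast
  define a where "a = (-1) ^ (i + 1) * (c i / b)"
  have \<xi>: "\<xi> i t = a * deriv k t" for t by (simp add: \<xi>_def a_def)
  define q where "q t = 2 * (\<Sum>j=1..<i. \<zeta> j t / c j) + defect t / b" for t
  let ?\<gamma> = "\<lambda>t. cos (\<theta> t i) / c i - 2 * \<rho> t"
  let ?\<delta> = "\<lambda>t. - (q t * cos (\<theta> t i)) + 2 * (\<rho> t * \<xi> i t) - a * (inverse (v t) * deriv (deriv k) t)"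
  have "((\<lambda>t. 2 * (\<Sum>j=1..<i. \<zeta> j t * (1 / c j)) + defect t * (1 / b)) \<longlongrightarrow>
      2 * (\<Sum>j=1..<i. 0 * (1 / c j)) + 0 * (1 / b)) at_top"
    using i by (intro tendsto_intros less.IH defect_tendsto_0) auto
  then have q: "(q \<longlongrightarrow> 0) at_top" by (simp add: q_def[abs_def])
  show ?case
  proof (rule fast_relaxation[OF _ v_at_top])
    show "eventually (\<lambda>t. (\<zeta> i has_real_derivative v t * (?\<delta> t - ?\<gamma> t * \<zeta> i t)) (at t)) at_top"
      using eventually_gt_at_top[of 0]
    proof eventually_elim
      case (elim t)
      have v: "v t \<noteq> 0" using v_pos[of t] elim by simp
      define s where "s j = sin (\<theta> t j)" for j
      define p where "p = s i / c i + 2 * (\<Sum>j=1..<i. s j / c j) + \<omega> t / v t"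
      have sq: "((\<lambda>t. (v t)\<^sup>2) has_real_derivative 2 * v t * accel t) (at t)"
        using DERIV_power[OF derivs(1)[OF elim], of 2] by (simp add: mult_ac)
      have "((\<lambda>t. (v t)\<^sup>2 * sin (\<theta> t i)) has_real_derivative
          2 * v t * accel t * s i + (- cos (\<theta> t i) * v t * p) * (v t)\<^sup>2) (at t)"
        using DERIV_mult[OF sq sin_\<theta>_deriv[OF elim i]] unfolding p_def s_def .
      then have "(\<zeta> i has_real_derivative
          2 * v t * accel t * s i + (- cos (\<theta> t i) * v t * p) * (v t)\<^sup>2 - a * deriv (deriv k) t) (at t)"
        unfolding \<zeta>_def[abs_def] \<xi> by (intro DERIV_diff DERIV_cmult k_deriv2)
      moreover have "(v t)\<^sup>2 * p = \<zeta> i t / c i + q t"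
      proof -
        have s: "(v t)\<^sup>2 * (s j / c j) = \<zeta> j t / c j + \<xi> j t / c j" for j
          by (simp add: \<zeta>_def s_def diff_divide_distrib)
        have "(v t)\<^sup>2 * (\<Sum>j=1..<i. s j / c j) = (\<Sum>j=1..<i. \<zeta> j t / c j + \<xi> j t / c j)"
          unfolding sum_distrib_left by (intro sum.cong refl s)
        with s[of i] have "(v t)\<^sup>2 * (s i / c i + 2 * (\<Sum>j=1..<i. s j / c j))
            = \<zeta> i t / c i + \<xi> i t / c i + 2 * (\<Sum>j=1..<i. \<zeta> j t / c j + \<xi> j t / c j)"
          by (simp add: distrib_left)
        also have "\<dots> = \<zeta> i t / c i + 2 * (\<Sum>j=1..<i. \<zeta> j t / c j) + deriv k t / b"
          using \<xi>_balance[OF i, of t] by (simp add: sum.distrib)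
        finally have "(v t)\<^sup>2 * (s i / c i + 2 * (\<Sum>j=1..<i. s j / c j)) = \<dots>" .
        moreover have "(v t)\<^sup>2 * (\<omega> t / v t) + deriv k t / b = defect t / b"
          using v b by (simp add: defect_def field_simps power2_eq_square)
        ultimately show ?thesis unfolding p_def q_def distrib_left by linarith
      qed
      then have "(- cos (\<theta> t i) * v t * p) * (v t)\<^sup>2 = - cos (\<theta> t i) * v t * (\<zeta> i t / c i + q t)"
        by (metis mult.assoc mult.commute)
      moreover have "2 * v t * accel t * s i = 2 * v t * \<rho> t * (\<zeta> i t + \<xi> i t)"
        unfolding accel_eq[OF less_imp_le[OF elim]] \<zeta>_def s_def by simp
      moreover have "2 * v t * \<rho> t * (\<zeta> i t + \<xi> i t) + - cos (\<theta> t i) * v t * (\<zeta> i t / c i + q t)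
          - a * deriv (deriv k) t = v t * (?\<delta> t - ?\<gamma> t * \<zeta> i t)"
        using v by (simp add: algebra_simps)
      ultimately show ?case by (simp only:)
    qed
    have "eventually (\<lambda>t. 1 / 2 / c i \<le> cos (\<theta> t i) / c i) at_top"
      using eventually_ge_at_top[of 0]
      by eventually_elim (use ci i \<theta>_le in \<open>intro divide_right_mono cos_ge_half, auto\<close>)
    moreover have "eventually (\<lambda>t. \<rho> t < 1 / 8 / c i) at_top"
      using ci by (intro order_tendstoD(2)[OF \<rho>_tendsto_0]) simp
    ultimately show "eventually (\<lambda>t. 1 / 4 / c i \<le> ?\<gamma> t) at_top"
      by eventually_elim (simp add: field_simps)
    show "0 < 1 / 4 / c i" using ci by simp
    have "(?\<delta> \<longlongrightarrow> - 0 + 2 * 0 - a * 0) at_top"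
      by (intro tendsto_intros tendsto_zero_times_bounded[OF q, of _ 1]
          tendsto_zero_times_bounded[OF \<rho>_tendsto_0 B] tendsto_zero_times_bounded[OF inverse_v K']) simp
    then show "(?\<delta> \<longlongrightarrow> 0) at_top" by simp
  qed
qed

section \<open>The growth law and the asymptotic formulas\<close>

text \<open>
  Passing from \<open>sin \<theta>\<^sub>i\<close> to \<open>\<theta>\<^sub>i\<close> costs a cubic error. Multiplied by \<open>v\<^sup>2\<close> it is at most \<open>\<theta>\<^sub>i\<^sup>2\<close> times
  \<open>v\<^sup>2 \<bar>sin \<theta>\<^sub>i\<bar>\<close>, where the second factor stays bounded.
\<close>

lemma v2_\<theta>_tendsto:
  assumes i: "i \<in> {1..N}"
  shows "((\<lambda>t. (v t)\<^sup>2 * \<theta> t i - \<xi> i t) \<longlongrightarrow> 0) at_top"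
proof -
  obtain B where B: "\<And>t. 0 \<le> t \<Longrightarrow> \<bar>\<xi> i t\<bar> \<le> B" by (rule \<xi>_bounded) blast
  have sq: "((\<lambda>t. (\<theta> t i)\<^sup>2) \<longlongrightarrow> 0) at_top"
    using tendsto_power[OF \<theta>_tendsto_0[OF i], of 2] by simp
  have "((\<lambda>t. (\<theta> t i)\<^sup>2 * \<bar>\<zeta> i t\<bar> + (\<theta> t i)\<^sup>2 * \<bar>\<xi> i t\<bar>) \<longlongrightarrow> 0 * \<bar>0\<bar> + 0) at_top"
    by (intro tendsto_intros sq \<zeta>_tendsto_0 i tendsto_zero_times_bounded[of _ _ B]) (simp add: B)
  then have lim: "((\<lambda>t. (\<theta> t i)\<^sup>2 * \<bar>\<zeta> i t\<bar> + (\<theta> t i)\<^sup>2 * \<bar>\<xi> i t\<bar>) \<longlongrightarrow> 0) at_top" by simp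
  have "((\<lambda>t. (v t)\<^sup>2 * (sin (\<theta> t i) - \<theta> t i)) \<longlongrightarrow> 0) at_top"
  proof (rule Lim_null_comparison[OF _ lim])
    show "eventually (\<lambda>t. norm ((v t)\<^sup>2 * (sin (\<theta> t i) - \<theta> t i))
        \<le> (\<theta> t i)\<^sup>2 * \<bar>\<zeta> i t\<bar> + (\<theta> t i)\<^sup>2 * \<bar>\<xi> i t\<bar>) at_top"
      using eventually_ge_at_top[of 0]
    proof eventually_elim
      case (elim t)
      let ?x = "\<theta> t i"
      have "\<bar>?x\<bar> ^ 3 = ?x\<^sup>2 * \<bar>?x\<bar>" by (simp add: power3_eq_cube power2_eq_square)
      also have "\<dots> \<le> ?x\<^sup>2 * (2 * \<bar>sin ?x\<bar>)" by (intro mult_left_mono \<theta>_le_sin elim i) simp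
      also have "\<dots> = 2 * (?x\<^sup>2 * \<bar>sin ?x\<bar>)" by simp
      finally have "\<bar>?x\<bar> ^ 3 \<le> 2 * (?x\<^sup>2 * \<bar>sin ?x\<bar>)" .
      moreover have "0 \<le> ?x\<^sup>2 * \<bar>sin ?x\<bar>" by simp
      ultimately have "\<bar>?x\<bar> ^ 3 / 6 \<le> ?x\<^sup>2 * \<bar>sin ?x\<bar>" by linarith
      then have "\<bar>sin ?x - ?x\<bar> \<le> ?x\<^sup>2 * \<bar>sin ?x\<bar>"
        by (rule order_trans[OF abs_sin_diff_le])
      then have "norm ((v t)\<^sup>2 * (sin ?x - ?x)) \<le> (v t)\<^sup>2 * (?x\<^sup>2 * \<bar>sin ?x\<bar>)"
        by (simp add: abs_mult mult_left_mono)
      also have "\<dots> = ?x\<^sup>2 * \<bar>\<zeta> i t + \<xi> i t\<bar>" by (simp add: \<zeta>_def abs_mult)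
      also have "\<dots> \<le> ?x\<^sup>2 * (\<bar>\<zeta> i t\<bar> + \<bar>\<xi> i t\<bar>)" by (intro mult_left_mono abs_triangle_ineq) simp
      finally show ?case by (simp only: distrib_left)
    qed
  qed
  from tendsto_diff[OF \<zeta>_tendsto_0[OF i] this] show ?thesis
    by (simp add: \<zeta>_def algebra_simps)
qed

definition mean :: real where
  "mean = 1 / P * integral {0..P} (\<lambda>t. (deriv k t)\<^sup>2)"

lemma mean_pos: "0 < mean"
proof (rule ccontr)
  assume neg: "\<not> 0 < mean"
  have cont: "continuous_on {0..P} (\<lambda>t. (deriv k t)\<^sup>2)" by (intro continuous_intros continuous_deriv_k)
  have "0 \<le> integral {0..P} (\<lambda>t. (deriv k t)\<^sup>2)"
    by (intro integral_nonneg integrable_continuous_interval cont) simp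
  then have "integral {0..P} (\<lambda>t. (deriv k t)\<^sup>2) = 0"
    using neg P by (simp add: mean_def zero_less_mult_iff zero_less_divide_iff)
  then have k0: "deriv k t = 0" if "t \<in> {0..P}" for t
    using integral_eq_0_iff[OF cont P] that by simp
  obtain C where C: "\<And>t. t \<in> {0..P} \<Longrightarrow> k t = C"
    using has_field_derivative_zero_constant[of "{0..P}" k] has_field_derivative_at_within[OF k_deriv] k0
    by (metis convex_real_interval(5))
  have "k t = C" for t
  proof -
    define n where "n = \<lfloor>t / P\<rfloor>"
    have "of_int n \<le> t / P" "t / P < of_int n + 1" unfolding n_def by linarith+
    then have mem: "t - of_int n * P \<in> {0..P}" using P by (auto simp: field_simps)
    have "k t = k (t - of_int n * P)"
    proof (cases "0 \<le> n")
      case True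
      then show ?thesis using k_shift[of "t - of_int n * P" "nat n"] by simp
    next
      case False
      then show ?thesis using k_shift[of t "nat (- n)"] by simp
    qed
    with C[OF mem] show ?thesis by simp
  qed
  with nonconstant show False by blast
qed

text \<open>
  The derivative of \<open>u\<^sup>3\<close> is \<open>3 b \<surd>\<Phi>\<^sub>0 (v \<omega>)\<^sup>2\<close>, and \<open>v \<omega>\<close> is asymptotically \<open>- k' / b\<close>. The periodic main
  part contributes its mean, and the remainder \<open>h\<close> tends to 0, hence so does its time average.
\<close>

lemma u_cube_tendsto: "((\<lambda>t. u t ^ 3 / t) \<longlongrightarrow> 3 * sqrt M / b * mean) at_top"
proof -
  define g where "g t = 3 * sqrt M / b * (deriv k t)\<^sup>2" for t
  define q where "q t = sqrt (Phi0 N M \<mu> (\<theta> t))" for t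
  define H where "H t = u t ^ 3 - integral {0..t} g" for t
  define h where "h t = 3 / b * (q t * (defect t - deriv k t)\<^sup>2 - sqrt M * (deriv k t)\<^sup>2)" for t
  have cont: "continuous_on A g" for A unfolding g_def by (intro continuous_intros continuous_deriv_k)
  have H': "(H has_real_derivative h t) (at t)" if t: "0 < t" for t
  proof -
    have "((\<lambda>t. u t ^ 3) has_real_derivative 3 * (u t)\<^sup>2 * (b * (\<omega> t)\<^sup>2 / q t)) (at t)"
      using DERIV_power[OF derivs(4)[OF t], of 3] by (simp add: q_def mult_ac)
    moreover have "((\<lambda>t. integral {0..t} g) has_real_derivative g t) (at t)"
    proof -
      have "((\<lambda>t. integral {0..t} g) has_real_derivative g t) (at t within {0..t + 1})"
        using t by (intro integral_has_real_derivative cont) auto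
      moreover have "at t within {0..t + 1} = at t" using t by (intro at_within_interior) auto
      ultimately show ?thesis by simp
    qed
    ultimately have "(H has_real_derivative 3 * (u t)\<^sup>2 * (b * (\<omega> t)\<^sup>2 / q t) - g t) (at t)"
      unfolding H_def[abs_def] by (rule DERIV_diff)
    moreover have "3 * (u t)\<^sup>2 * (b * (\<omega> t)\<^sup>2 / q t) - g t = h t"
    proof -
      have "0 < q t" unfolding q_def using Phi0_pos by simp
      moreover have "u t = v t * q t" by (simp add: u_def q_def)
      ultimately show ?thesis
        using b by (simp add: h_def g_def defect_def field_simps power2_eq_square)
    qed
    ultimately show ?thesis by simp
  qed
  obtain K where K: "\<And>t. 0 \<le> t \<Longrightarrow> \<bar>deriv k t\<bar> \<le> K" by (rule deriv_k_bounded) blast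
  have K2: "\<bar>(deriv k t)\<^sup>2\<bar> \<le> K\<^sup>2" if "0 \<le> t" for t
    using power_mono[OF K[OF that] abs_ge_zero, of 2] by simp
  define p where "p t = q t - sqrt M" for t
  have "((\<lambda>t. q t - sqrt M) \<longlongrightarrow> sqrt M - sqrt M) at_top"
    unfolding q_def by (intro tendsto_intros Phi_tendsto)
  then have p: "(p \<longlongrightarrow> 0) at_top" by (simp add: p_def[abs_def])
  have h_eq: "h t = 3 / b * (p t * (defect t)\<^sup>2 - 2 * p t * (defect t * deriv k t) + p t * (deriv k t)\<^sup>2
      + sqrt M * ((defect t)\<^sup>2 - 2 * (defect t * deriv k t)))" for t
    unfolding h_def p_def by (simp add: algebra_simps power2_eq_square)
  have ek: "((\<lambda>t. defect t * deriv k t) \<longlongrightarrow> 0) at_top"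
    by (rule tendsto_zero_times_bounded[OF defect_tendsto_0 K])
  have pk: "((\<lambda>t. p t * (deriv k t)\<^sup>2) \<longlongrightarrow> 0) at_top"
    by (rule tendsto_zero_times_bounded[OF p K2])
  have "(h \<longlongrightarrow> 3 / b * (0 * 0\<^sup>2 - 2 * 0 * 0 + 0 + sqrt M * (0\<^sup>2 - 2 * 0))) at_top"
    unfolding h_eq[abs_def] by (intro tendsto_intros p ek pk defect_tendsto_0)
  then have h: "(h \<longlongrightarrow> 0) at_top" by simp
  have "((\<lambda>t. H t / t) \<longlongrightarrow> 0) at_top"
  proof (rule lhospital_at_top_at_top[where f' = h and g' = "\<lambda>_. 1"])
    show "eventually (\<lambda>t. (H has_real_derivative h t) (at t)) at_top"
      using eventually_gt_at_top[of 0] by eventually_elim (rule H')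
  qed (use h in \<open>auto intro!: filterlim_ident\<close>)
  moreover have "((\<lambda>t. integral {0..t} g / t) \<longlongrightarrow> integral {0..P} g / P) at_top"
    by (rule periodic_mean[OF cont _ P]) (simp add: g_def periodic_deriv_k)
  ultimately have "((\<lambda>t. H t / t + integral {0..t} g / t) \<longlongrightarrow> 0 + integral {0..P} g / P) at_top"
    by (rule tendsto_add)
  moreover have "integral {0..P} g / P = 3 * sqrt M / b * mean"
    unfolding g_def mean_def by simp
  ultimately show ?thesis by (simp add: H_def diff_divide_distrib)
qed

definition \<Delta> :: real where
  "\<Delta> = 3 * mean / (b * M)"

lemma \<Delta>_pos: "0 < \<Delta>"
  using mean_pos b M_pos by (simp add: \<Delta>_def)

lemma v_over_cube_root: "((\<lambda>t. v t / t powr (1/3)) \<longlongrightarrow> \<Delta> powr (1/3)) at_top"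
proof -
  have "((\<lambda>t. (u t ^ 3 / t) / sqrt (Phi0 N M \<mu> (\<theta> t)) ^ 3) \<longlongrightarrow> (3 * sqrt M / b * mean) / sqrt M ^ 3) at_top"
    using M_pos by (intro tendsto_intros u_cube_tendsto Phi_tendsto) auto
  moreover have "(3 * sqrt M / b * mean) / sqrt M ^ 3 = \<Delta>"
  proof -
    have "sqrt M ^ 3 = sqrt M * M" using M_pos by (simp add: power3_eq_cube)
    then show ?thesis using M_pos b by (simp add: \<Delta>_def field_simps)
  qed
  moreover have "(u t ^ 3 / t) / sqrt (Phi0 N M \<mu> (\<theta> t)) ^ 3 = v t ^ 3 / t" for t
    using Phi0_pos[of "\<theta> t"] by (simp add: v_eq[of t] power_divide)
  ultimately have "((\<lambda>t. v t ^ 3 / t) \<longlongrightarrow> \<Delta>) at_top" by simp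
  then have "((\<lambda>t. (v t ^ 3 / t) powr (1/3)) \<longlongrightarrow> \<Delta> powr (1/3)) at_top"
    using \<Delta>_pos by (intro tendsto_powr tendsto_const) auto
  moreover have "eventually (\<lambda>t. (v t ^ 3 / t) powr (1/3) = v t / t powr (1/3)) at_top"
    using eventually_gt_at_top[of 0]
  proof eventually_elim
    case (elim t)
    have "0 < v t" using v_pos elim by simp
    then have "(v t ^ 3) powr (1/3) = v t"
      by (simp add: powr_powr flip: powr_numeral)
    then show ?case using elim \<open>0 < v t\<close> by (simp add: powr_divide)
  qed
  ultimately show ?thesis by (rule Lim_transform_eventually)
qed

lemma cube_root_over_v: "((\<lambda>t. t powr (1/3) / v t) \<longlongrightarrow> 1 / \<Delta> powr (1/3)) at_top"
proof -
  have "((\<lambda>t. 1 / (v t / t powr (1/3))) \<longlongrightarrow> 1 / \<Delta> powr (1/3)) at_top"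
    using \<Delta>_pos by (intro tendsto_intros v_over_cube_root) auto
  then show ?thesis by simp
qed

lemma powr_neg_thirds:
  fixes x :: real
  assumes "0 < x"
  shows "x powr (-1/3) = 1 / x powr (1/3)" "x powr (-2/3) = 1 / (x powr (1/3))\<^sup>2"
proof -
  show "x powr (-1/3) = 1 / x powr (1/3)"
    using powr_minus_divide[of x "1/3"] by simp
  have "(x powr (1/3))\<^sup>2 = x powr (2/3)"
    by (simp add: power2_eq_square flip: powr_add)
  then show "x powr (-2/3) = 1 / (x powr (1/3))\<^sup>2"
    using powr_minus_divide[of x "2/3"] by simp
qed

lemma v_asymptotics: "(\<lambda>t. v t - \<Delta> powr (1/3) * t powr (1/3)) \<in> o[at_top](\<lambda>t. t powr (1/3))"
proof (rule smalloI_tendsto)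
  have "((\<lambda>t. v t / t powr (1/3) - \<Delta> powr (1/3)) \<longlongrightarrow> 0) at_top"
    using v_over_cube_root by (simp add: LIM_zero_iff)
  moreover have "eventually (\<lambda>t. v t / t powr (1/3) - \<Delta> powr (1/3)
      = (v t - \<Delta> powr (1/3) * t powr (1/3)) / t powr (1/3)) at_top"
    using eventually_gt_at_top[of 0] by eventually_elim (simp add: diff_divide_distrib)
  ultimately show "((\<lambda>t. (v t - \<Delta> powr (1/3) * t powr (1/3)) / t powr (1/3)) \<longlongrightarrow> 0) at_top"
    by (rule Lim_transform_eventually)
  show "eventually (\<lambda>t::real. t powr (1/3) \<noteq> 0) at_top"
    using eventually_gt_at_top[of 0] by eventually_elim simp
qed

lemma \<omega>_asymptotics:
  "(\<lambda>t. \<omega> t - (- (deriv k t / (b * \<Delta> powr (1/3))) * t powr (-1/3))) \<in> o[at_top](\<lambda>t. t powr (-1/3))"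
proof (rule smalloI_tendsto)
  obtain K where K: "\<And>t. 0 \<le> t \<Longrightarrow> \<bar>deriv k t\<bar> \<le> K" by (rule deriv_k_bounded) blast
  define D where "D = \<Delta> powr (1/3)"
  define r where "r t = t powr (1/3) / v t" for t
  have D: "0 < D" using \<Delta>_pos by (simp add: D_def)
  have r: "(r \<longlongrightarrow> 1 / D) at_top" unfolding r_def[abs_def] D_def by (rule cube_root_over_v)
  then have "((\<lambda>t. r t - 1 / D) \<longlongrightarrow> 0) at_top" by (simp add: LIM_zero_iff)
  from tendsto_zero_times_bounded[OF this K]
  have "((\<lambda>t. defect t * (1 / b) * r t - 1 / b * ((r t - 1 / D) * deriv k t)) \<longlongrightarrow> 0 * (1 / b) * (1 / D) - 1 / b * 0) at_top"
    by (intro tendsto_intros defect_tendsto_0 r)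
  then have "((\<lambda>t. defect t * (1 / b) * r t - 1 / b * ((r t - 1 / D) * deriv k t)) \<longlongrightarrow> 0) at_top" by simp
  moreover have "eventually (\<lambda>t. defect t * (1 / b) * r t - 1 / b * ((r t - 1 / D) * deriv k t)
      = (\<omega> t - (- (deriv k t / (b * D)) * t powr (-1/3))) / t powr (-1/3)) at_top"
    using eventually_gt_at_top[of 0]
  proof eventually_elim
    case (elim t)
    have "0 < v t" "0 < t powr (1/3)" using v_pos elim by simp_all
    then show ?case
      unfolding powr_neg_thirds[OF elim] defect_def r_def using b D
      by (simp add: field_simps)
  qed
  ultimately show "((\<lambda>t. (\<omega> t - (- (deriv k t / (b * \<Delta> powr (1/3))) * t powr (-1/3))) / t powr (-1/3)) \<longlongrightarrow> 0) at_top"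
    unfolding D_def by (rule Lim_transform_eventually)
  show "eventually (\<lambda>t::real. t powr (-1/3) \<noteq> 0) at_top"
    using eventually_gt_at_top[of 0] by eventually_elim simp
qed

lemma \<theta>_asymptotics:
  assumes i: "i \<in> {1..N}"
  shows "(\<lambda>t. \<theta> t i - (-1) ^ (i + 1) * (c i * deriv k t / b) * \<Delta> powr (-2/3) * t powr (-2/3))
    \<in> o[at_top](\<lambda>t. t powr (-2/3))"
proof (rule smalloI_tendsto)
  obtain B where B: "\<And>t. 0 \<le> t \<Longrightarrow> \<bar>\<xi> i t\<bar> \<le> B" by (rule \<xi>_bounded) blast
  define D where "D = \<Delta> powr (1/3)"
  define r where "r t = t powr (1/3) / v t" for t
  have D: "0 < D" using \<Delta>_pos by (simp add: D_def)
  have r: "(r \<longlongrightarrow> 1 / D) at_top" unfolding r_def[abs_def] D_def by (rule cube_root_over_v)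
  have "((\<lambda>t. (r t)\<^sup>2 - (1 / D)\<^sup>2) \<longlongrightarrow> 0) at_top"
    using tendsto_power[OF r, of 2] by (simp add: LIM_zero_iff)
  from tendsto_zero_times_bounded[OF this B]
  have "((\<lambda>t. ((v t)\<^sup>2 * \<theta> t i - \<xi> i t) * (r t)\<^sup>2 + ((r t)\<^sup>2 - (1 / D)\<^sup>2) * \<xi> i t) \<longlongrightarrow> 0 * (1 / D)\<^sup>2 + 0) at_top"
    by (intro tendsto_intros v2_\<theta>_tendsto i r)
  then have "((\<lambda>t. ((v t)\<^sup>2 * \<theta> t i - \<xi> i t) * (r t)\<^sup>2 + ((r t)\<^sup>2 - (1 / D)\<^sup>2) * \<xi> i t) \<longlongrightarrow> 0) at_top"
    by simp
  moreover have "eventually (\<lambda>t. ((v t)\<^sup>2 * \<theta> t i - \<xi> i t) * (r t)\<^sup>2 + ((r t)\<^sup>2 - (1 / D)\<^sup>2) * \<xi> i t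
      = (\<theta> t i - \<xi> i t * (1 / D\<^sup>2) * t powr (-2/3)) / t powr (-2/3)) at_top"
    using eventually_gt_at_top[of 0]
  proof eventually_elim
    case (elim t)
    have "0 < v t" "0 < t powr (1/3)" using v_pos elim by simp_all
    then show ?case
      unfolding powr_neg_thirds(2)[OF elim] r_def using D
      by (simp add: field_simps)
  qed
  ultimately have "((\<lambda>t. (\<theta> t i - \<xi> i t * (1 / D\<^sup>2) * t powr (-2/3)) / t powr (-2/3)) \<longlongrightarrow> 0) at_top"
    by (rule Lim_transform_eventually)
  then show "((\<lambda>t. (\<theta> t i - (-1) ^ (i + 1) * (c i * deriv k t / b) * \<Delta> powr (-2/3) * t powr (-2/3))
      / t powr (-2/3)) \<longlongrightarrow> 0) at_top"
    unfolding \<xi>_def D_def powr_neg_thirds(2)[OF \<Delta>_pos] .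
  show "eventually (\<lambda>t::real. t powr (-2/3) \<noteq> 0) at_top"
    using eventually_gt_at_top[of 0] by eventually_elim simp
qed

end

section \<open>Trajectories with fast and nearly straight initial motion\<close>

context vehicle
begin

text \<open>
  A small \<open>\<epsilon>\<close> forces a large \<open>v\<close> for all times, hence a small ratio \<open>\<bar>\<omega>\<bar> / v\<close>, which is what the barriers
  for the angles need.
\<close>

lemma small_data_trajectory_global:
  "\<exists>\<epsilon>>0. \<exists>\<omega>\<^sub>0>0. \<exists>\<theta>\<^sub>0 :: nat \<Rightarrow> real. (\<forall>i\<in>{1..N}. \<theta>\<^sub>0 i > 0) \<and>
    (\<forall>S v \<omega> \<theta>. is_trajectory N J b M \<mu> c k S v \<omega> \<theta> \<longrightarrow>
       v 0 > 1 / \<epsilon> \<longrightarrow> \<bar>\<omega> 0\<bar> < \<omega>\<^sub>0 * \<epsilon>\<^sup>2 \<longrightarrow> (\<forall>i\<in>{1..N}. \<bar>\<theta> 0 i\<bar> < \<theta>\<^sub>0 i * \<epsilon>\<^sup>2) \<longrightarrow>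
       S = {0..} \<and> global_solution N J b M P \<phi> \<mu> c k v \<omega> \<theta>)"
proof -
  obtain K where K: "0 < K" "\<And>t. 0 \<le> t \<Longrightarrow> \<bar>deriv k t\<bar> \<le> K" by (rule deriv_k_bounded) blast
  define \<kappa> where "\<kappa> = sqrt (\<phi> / Phi_max)"
  have \<kappa>: "0 < \<kappa>" using \<phi> Phi_max_pos by (simp add: \<kappa>_def)
  \<comment> \<open>\<open>W\<close> bounds \<open>\<bar>\<omega>\<bar>\<close> for every \<open>\<epsilon> \<le> 1\<close>, as then \<open>v \<ge> \<kappa>\<close> throughout.\<close>
  define W where "W = 1 + K / (b * \<kappa>)"
  have W: "1 \<le> W" "b * \<kappa> * W = b * \<kappa> + K"
    using K(1) b \<kappa> by (simp_all add: W_def field_simps)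
  define \<Sigma> where "\<Sigma> = (\<Sum>i=1..N. c i * 8 ^ i)"
  have \<Sigma>: "0 \<le> \<Sigma>" unfolding \<Sigma>_def using c by (intro sum_nonneg) (simp add: less_imp_le)
  \<comment> \<open>Small enough for all barriers \<open>c\<^sub>i \<delta> 8\<^sup>i\<close> to be at most \<open>1 / 2\<close>.\<close>
  define \<delta> where "\<delta> = 1 / (2 * (1 + \<Sigma>))"
  have \<delta>: "0 < \<delta>" using \<Sigma> by (simp add: \<delta>_def)
  have half: "c i * \<delta> * 8 ^ i \<le> 1 / 2" if i: "i \<in> {1..N}" for i
  proof -
    have "c i * 8 ^ i \<le> \<Sigma>"
      unfolding \<Sigma>_def using i c by (intro member_le_sum) (auto simp: less_imp_le)
    then have "c i * 8 ^ i * \<delta> \<le> (1 + \<Sigma>) * \<delta>" using \<delta> by (intro mult_right_mono) auto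
    also have "\<dots> = 1 / 2" using \<Sigma> by (simp add: \<delta>_def field_simps)
    finally show ?thesis by (simp add: mult_ac)
  qed
  \<comment> \<open>The second bound gives \<open>W \<le> \<delta> \<kappa> / \<epsilon> \<le> \<delta> v\<close>.\<close>
  define \<epsilon> where "\<epsilon> = min 1 (\<kappa> * \<delta> / W)"
  have \<epsilon>: "0 < \<epsilon>" "\<epsilon> \<le> 1" "\<epsilon> \<le> \<kappa> * \<delta> / W" using \<kappa> \<delta> W by (auto simp: \<epsilon>_def)
  have \<epsilon>2: "\<epsilon>\<^sup>2 \<le> 1" using \<epsilon> by (simp add: power_le_one)
  have "S = {0..} \<and> global_solution N J b M P \<phi> \<mu> c k v \<omega> \<theta>"
    if traj: "is_trajectory N J b M \<mu> c k S v \<omega> \<theta>" and fast: "v 0 > 1 / \<epsilon>" and \<omega>0: "\<bar>\<omega> 0\<bar> < 1 * \<epsilon>\<^sup>2"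
      and \<theta>0: "\<forall>i\<in>{1..N}. \<bar>\<theta> 0 i\<bar> < c i * \<delta> * 8 ^ i * \<epsilon>\<^sup>2" for S v \<omega> \<theta>
  proof -
    have v0_pos: "0 < v 0" using fast \<epsilon>(1) by (meson less_trans zero_less_divide_1_iff)
    have sol: "is_solution N J b M \<mu> c k S v \<omega> \<theta>" using traj by (simp add: is_trajectory_def)
    interpret vehicle_solution N J b M P \<phi> \<mu> c k S v \<omega> \<theta>
      by unfold_locales (use sol v0_pos in auto)
    have S_eq: "S = {0..}" by (rule trajectory_global[OF traj])
    define V where "V = v 0 * \<kappa>"
    have "1 / \<epsilon> * \<kappa> \<le> V" unfolding V_def using fast \<kappa> by (intro mult_right_mono less_imp_le)
    moreover have "\<kappa> \<le> 1 / \<epsilon> * \<kappa>" using \<epsilon> \<kappa> by (simp add: field_simps)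
    moreover have "W \<le> \<delta> * (1 / \<epsilon> * \<kappa>)" using \<epsilon>(1,3) W(1) by (simp add: field_simps)
    ultimately have V: "\<kappa> \<le> V" "W \<le> \<delta> * V"
      using mult_left_mono[of "1 / \<epsilon> * \<kappa>" V \<delta>] \<delta> by auto
    have Vv: "V \<le> v t" if "t \<in> S" for t using v_lower[OF that] by (simp add: V_def \<kappa>_def)
    have W_bound: "\<bar>\<omega> t\<bar> \<le> W" if "t \<in> S" for t
    proof (rule \<omega>_bound[OF _ Vv K(2) _ _ that])
      show "0 < V" using V \<kappa> by linarith
      show "\<bar>\<omega> 0\<bar> \<le> W" using \<omega>0 \<epsilon>2 W(1) by linarith
      have "K \<le> b * \<kappa> * W" using W(2) b \<kappa> by simp
      also have "\<dots> \<le> b * V * W" using V(1) b W(1) by (intro mult_right_mono mult_left_mono) auto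
      finally show "K \<le> b * V * W" .
    qed
    have "\<bar>\<theta> t i\<bar> \<le> c i * \<delta> * 8 ^ i" if "t \<in> S" "i \<in> {1..N}" for t i
    proof (rule \<theta>_bound[OF \<delta> half _ _ that(2,1)])
      show "\<bar>\<omega> t\<bar> \<le> \<delta> * v t" if "t \<in> S" for t
        using W_bound[OF that] V(2) mult_left_mono[OF Vv[OF that] less_imp_le[OF \<delta>]] by linarith
      show "\<bar>\<theta> 0 i\<bar> \<le> c i * \<delta> * 8 ^ i" if i: "i \<in> {1..N}" for i
      proof -
        have "c i * \<delta> * 8 ^ i * \<epsilon>\<^sup>2 \<le> c i * \<delta> * 8 ^ i * 1"
          using \<epsilon>2 c[OF i] \<delta> by (intro mult_left_mono) auto
        then show ?thesis using \<theta>0 i by fastforce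
      qed
    qed
    then have "\<bar>\<theta> t i\<bar> \<le> 1" if "0 \<le> t" "i \<in> {1..N}" for t i
      using half[OF that(2)] that S_eq by fastforce
    then have "global_solution N J b M P \<phi> \<mu> c k v \<omega> \<theta>"
      using vehicle_solution_axioms unfolding S_eq
      by (intro global_solution.intro global_solution_axioms.intro)
    with S_eq show ?thesis by simp
  qed
  then show ?thesis
    using \<epsilon>(1) c \<delta> by (intro exI[of _ \<epsilon>] exI[of _ 1] exI[of _ "\<lambda>i. c i * \<delta> * 8 ^ i"] conjI allI impI ballI) auto
qed

end

text \<open>
  Completing the square, \<open>c\<^sub>i\<^sup>2 \<mu>\<^sub>i = I\<^sub>i + m\<^sub>i (a\<^sub>i - c\<^sub>i)\<^sup>2 - m\<^sub>i c\<^sub>i\<^sup>2\<close>. So \<open>\<mu>\<^sub>i \<ge> - m\<^sub>i\<close>, and the mass of each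
  trailer compensates its possibly negative term in \<open>\<Phi>\<^sub>0\<close>.
\<close>

lemma Phi0_ge_leading_mass:
  fixes m I a c \<mu> :: "nat \<Rightarrow> real"
  assumes m: "\<forall>i\<in>{0..N}. m i > 0" and I: "\<forall>i\<in>{0..N}. I i > 0" and c: "\<forall>i\<in>{1..N}. c i > 0"
    and M: "M = (\<Sum>i=0..N. m i)"
    and \<mu>: "\<forall>i\<in>{1..N}. \<mu> i = 1 / (c i)\<^sup>2 * (I i + m i * a i * (a i - 2 * c i))"
  shows "m 0 \<le> Phi0 N M \<mu> \<theta>"
proof -
  have "0 \<le> m i + \<mu> i * (sin (\<theta> i))\<^sup>2" if i: "i \<in> {1..N}" for i
  proof -
    have ci: "0 < c i" and mi: "0 < m i" and Ii: "0 < I i" using i c m I by auto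
    have "\<mu> i * (c i)\<^sup>2 = I i + m i * a i * (a i - 2 * c i)" using \<mu> i ci by simp
    also have "\<dots> = I i + m i * (a i - c i)\<^sup>2 - m i * (c i)\<^sup>2"
      by (simp add: power2_eq_square algebra_simps)
    also have "\<dots> \<ge> - m i * (c i)\<^sup>2" using mi Ii by simp
    finally have "- m i \<le> \<mu> i" by (rule mult_right_le_imp_le) (use ci in simp)
    then have "- m i * (sin (\<theta> i))\<^sup>2 \<le> \<mu> i * (sin (\<theta> i))\<^sup>2" by (intro mult_right_mono) auto
    moreover have "m i * (sin (\<theta> i))\<^sup>2 \<le> m i * 1"
      using mi by (intro mult_left_mono) (auto simp: abs_square_le_1)
    ultimately show ?thesis by linarith
  qed
  then have "0 \<le> (\<Sum>i=1..N. m i + \<mu> i * (sin (\<theta> i))\<^sup>2)" by (rule sum_nonneg)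
  then show ?thesis unfolding Phi0_def M by (simp add: sum.distrib sum.atLeast_Suc_atMost)
qed

theorem proposition2:
  fixes N :: nat
    and m I a c \<mu> :: "nat \<Rightarrow> real"
    and J b M P \<Delta> :: real
    and k :: "real \<Rightarrow> real"
  assumes "N \<ge> 1"
    and "\<forall>i\<in>{0..N}. m i > 0"
    and "\<forall>i\<in>{0..N}. I i > 0"
    and "a 0 > 0"
    and "\<forall>i\<in>{1..N}. c i > 0"
    and "J = I 0 + m 0 * (a 0)\<^sup>2"
    and "b = m 0 * a 0"
    and "M = (\<Sum>i=0..N. m i)"
    and "\<forall>i\<in>{1..N}. \<mu> i = 1 / (c i)\<^sup>2 * (I i + m i * a i * (a i - 2 * c i))"
    and "smooth k"
    and "\<not> (\<exists>C. \<forall>t. k t = C)"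
    and "P > 0"
    and "\<forall>t. k (t + P) = k t"
    and "\<Delta> = 3 * (1 / P * integral {0..P} (\<lambda>t. (deriv k t)\<^sup>2)) / (b * M)"
  shows "\<exists>\<epsilon>>0. \<exists>\<omega>\<^sub>0>0. \<exists>\<theta>\<^sub>0 :: nat \<Rightarrow> real. (\<forall>i\<in>{1..N}. \<theta>\<^sub>0 i > 0) \<and>
    (\<forall>S v \<omega> \<theta>.
       is_trajectory N J b M \<mu> c k S v \<omega> \<theta> \<longrightarrow>
       v 0 > 1 / \<epsilon> \<longrightarrow> \<bar>\<omega> 0\<bar> < \<omega>\<^sub>0 * \<epsilon>\<^sup>2 \<longrightarrow> (\<forall>i\<in>{1..N}. \<bar>\<theta> 0 i\<bar> < \<theta>\<^sub>0 i * \<epsilon>\<^sup>2) \<longrightarrow>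
       S = {0..} \<and>
       filterlim v at_top at_top \<and>
       (\<omega> \<longlongrightarrow> 0) at_top \<and>
       (\<forall>i\<in>{1..N}. ((\<lambda>t. \<theta> t i) \<longlongrightarrow> 0) at_top) \<and>
       (\<lambda>t. v t - \<Delta> powr (1/3) * t powr (1/3)) \<in> o[at_top](\<lambda>t. t powr (1/3)) \<and>
       (\<lambda>t. \<omega> t - (- (deriv k t / (b * \<Delta> powr (1/3))) * t powr (-1/3)))
          \<in> o[at_top](\<lambda>t. t powr (-1/3)) \<and>
       (\<forall>i\<in>{1..N}.
          (\<lambda>t. \<theta> t i - (-1) ^ (i + 1) * (c i * deriv k t / b) * \<Delta> powr (-2/3) * t powr (-2/3))
            \<in> o[at_top](\<lambda>t. t powr (-2/3))))"
proof -
  have m0: "0 < m 0" using assms(2) by simp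
  interpret vehicle N J b M P "m 0" \<mu> c k
  proof
    show "m 0 \<le> Phi0 N M \<mu> \<theta>" for \<theta>
      using assms(2,3,5,8,9) by (rule Phi0_ge_leading_mass)
    have "0 < I 0" using assms(3) by simp
    then show "0 < J" unfolding assms(6) using m0 by (simp add: add_pos_nonneg)
    show "0 < b" unfolding assms(7) using m0 assms(4) by simp
    show "0 < c i" if "i \<in> {1..N}" for i using assms(5) that by blast
    show "k (t + P) = k t" for t using assms(13) by blast
  qed (fact m0 assms(10) assms(11) assms(12))+
  show ?thesis (is "\<exists>\<epsilon>>0. \<exists>\<omega>\<^sub>0>0. \<exists>\<theta>\<^sub>0. ?pos \<theta>\<^sub>0 \<and> (\<forall>S v \<omega> \<theta>. ?traj S v \<omega> \<theta> \<longrightarrow> ?v \<epsilon> v \<longrightarrow> ?\<omega> \<epsilon> \<omega>\<^sub>0 \<omega> \<longrightarrow> ?\<theta> \<epsilon> \<theta>\<^sub>0 \<theta> \<longrightarrow> ?concl S v \<omega> \<theta>)")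
    using small_data_trajectory_global
  proof (elim exE conjE)
    fix \<epsilon> \<omega>\<^sub>0 :: real and \<theta>\<^sub>0 :: "nat \<Rightarrow> real"
    assume pos: "0 < \<epsilon>" "0 < \<omega>\<^sub>0" "?pos \<theta>\<^sub>0"
      and global: "\<forall>S v \<omega> \<theta>. ?traj S v \<omega> \<theta> \<longrightarrow> ?v \<epsilon> v \<longrightarrow> ?\<omega> \<epsilon> \<omega>\<^sub>0 \<omega> \<longrightarrow> ?\<theta> \<epsilon> \<theta>\<^sub>0 \<theta> \<longrightarrow>
        S = {0..} \<and> global_solution N J b M P (m 0) \<mu> c k v \<omega> \<theta>"
    have concl: "\<forall>S v \<omega> \<theta>. ?traj S v \<omega> \<theta> \<longrightarrow> ?v \<epsilon> v \<longrightarrow> ?\<omega> \<epsilon> \<omega>\<^sub>0 \<omega> \<longrightarrow> ?\<theta> \<epsilon> \<theta>\<^sub>0 \<theta> \<longrightarrow> ?concl S v \<omega> \<theta>"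
    proof (intro allI impI)
      fix S v \<omega> \<theta>
      assume hyps: "?traj S v \<omega> \<theta>" "?v \<epsilon> v" "?\<omega> \<epsilon> \<omega>\<^sub>0 \<omega>" "?\<theta> \<epsilon> \<theta>\<^sub>0 \<theta>"
      note sol = global[THEN spec, THEN spec, THEN spec, THEN spec, THEN mp, THEN mp, THEN mp, THEN mp, OF hyps]
      interpret g: global_solution N J b M P "m 0" \<mu> c k v \<omega> \<theta> by (rule conjunct2[OF sol])
      have \<Delta>: "\<Delta> = g.\<Delta>" using assms(14) by (simp only: g.\<Delta>_def g.mean_def)
      show "?concl S v \<omega> \<theta>"
        unfolding \<Delta>
        by (intro conjI ballI conjunct1[OF sol] g.v_at_top g.\<omega>_tendsto_0 g.\<theta>_tendsto_0
            g.v_asymptotics g.\<omega>_asymptotics g.\<theta>_asymptotics)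
    qed
    show ?thesis
      by (rule exI[of _ \<epsilon>], rule conjI, rule pos, rule exI[of _ \<omega>\<^sub>0], rule conjI, rule pos,
          rule exI[of _ \<theta>\<^sub>0], rule conjI, rule pos, rule concl)
  qed
qed

end
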